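(* Let $p$ be a prime and let $s_1,s_2$ be positive integers. Let $f,g\in\mathbb{Z}[x]$ be monic polynomials with nonzero resultant $r$, such that $v_p(f(n))\ge s_1$ and $v_p(g(n))\ge s_2$ for every integer $n$. Put $$S=\max_{n\in\mathbb{Z}}\min\{v_p(f(n)),v_p(g(n))\}.$$ Then $$v_p(r)\ \ge\ S-\max\{s_1,s_2\}+p\,s_1s_2\,\frac{p-1}{p-p^{-k}},\qquad\text{where } k=\big\lfloor \log_p\big((p-1)\max\{s_1,s_2\}+1\big)\big\rfloor-1 .$$
   Context: $v_p$ denotes the $p$-adic valuation. The resultant of monic $f(x)=\prod_i(x-\alpha_i)$, $g(x)=\prod_j(x-\beta_j)$ is $r=\prod_{i,j}(\alpha_i-\beta_j)$. The maximum $S$ is finite since $r\neq 0$. *)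

theory Defs
  imports "Subresultants.Resultant_Prelim" "HOL-Computational_Algebra.Primes"
    "HOL-Library.Extended_Real"
begin

definition vp :: "nat \<Rightarrow> int \<Rightarrow> enat" where
  "vp p x = (if x = 0 then \<infinity> else enat (multiplicity (int p) x))"

end

theory Submission
  imports "HOL-Algebra.Algebraic_Closure_Type" "Subresultants.Subresultant" Defs
begin

text \<open>
  Extend the \<open>p\<close>-adic valuation to a valuation \<open>v\<close> of an algebraic closure of the rationals, and let
  \<open>\<alpha>\<^sub>i\<close>, \<open>\<beta>\<^sub>j\<close> be the roots of \<open>f\<close> and \<open>g\<close>, so that the valuation of the resultant is the mutual
  energy \<open>\<Sum> v (\<alpha>\<^sub>i - \<beta>\<^sub>j)\<close>. The integers form a \<open>p\<close>-ary tree whose vertices at depth \<open>k\<close> are the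
  residue classes modulo \<open>p ^ k\<close>. The potential \<open>v (f n) = \<Sum> v (\<alpha>\<^sub>i - n)\<close> splits into
  contributions of the edges on the path to \<open>n\<close>; by Gauss's lemma these contributions are integers.
  The energy inside a class is at least the sum, over its \<open>p\<close> subclasses, of the product of the
  contributions of \<open>f\<close> and \<open>g\<close> on the connecting edge and of the energy inside the subclass.
  This gives the bound by induction. If potential at least \<open>s\<close> remains to be collected below a
  vertex, then the number of roots there is at least proportional to \<open>s\<close>. By integrality, the
  remaining potential drops from below \<open>1 + p + ... + p ^ l\<close> to below \<open>1 + p + ... + p ^ (l - 1)\<close>
  along each edge, so that only finitely many depths matter; this is where \<open>k\<close> comes from.
\<close>

section \<open>Extending the \<open>p\<close>-adic valuation\<close>

definition is_subring :: "'a::field set \<Rightarrow> bool" where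
  "is_subring R \<longleftrightarrow> 1 \<in> R \<and> (\<forall>x\<in>R. \<forall>y\<in>R. x - y \<in> R \<and> x * y \<in> R)"

lemma
  assumes "is_subring R"
  shows subring_1: "1 \<in> R"
    and subring_diff: "x \<in> R \<Longrightarrow> y \<in> R \<Longrightarrow> x - y \<in> R"
    and subring_mult: "x \<in> R \<Longrightarrow> y \<in> R \<Longrightarrow> x * y \<in> R"
  using assms by (auto simp: is_subring_def)

lemma subring_0: assumes "is_subring R" shows "0 \<in> R"
  using subring_diff[OF assms subring_1[OF assms] subring_1[OF assms]] by simp

lemma subring_minus: "is_subring R \<Longrightarrow> x \<in> R \<Longrightarrow> - x \<in> R"
  using subring_diff[of R 0 x] subring_0[of R] by simp

lemma subring_add: "is_subring R \<Longrightarrow> x \<in> R \<Longrightarrow> y \<in> R \<Longrightarrow> x + y \<in> R"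
  using subring_diff[of R x "- y"] subring_minus[of R y] by simp

lemma subring_sum: "is_subring R \<Longrightarrow> (\<And>i. i \<in> A \<Longrightarrow> f i \<in> R) \<Longrightarrow> sum f A \<in> R"
  by (induction A rule: infinite_finite_induct) (auto simp: subring_0 subring_add)

lemma subring_power: "is_subring R \<Longrightarrow> x \<in> R \<Longrightarrow> x ^ n \<in> R"
  by (induction n) (auto simp: subring_1 subring_mult)

lemma subring_of_nat: "is_subring R \<Longrightarrow> of_nat n \<in> R"
  by (induction n) (auto simp: subring_0 subring_1 subring_add)

lemma subring_of_int: "is_subring R \<Longrightarrow> of_int n \<in> R"
  by (cases n) (auto simp: subring_of_nat subring_minus simp del: of_nat_Suc)

lemma inverse_prime_not_Ints:
  assumes "prime p" shows "inverse (of_nat p :: 'a::field_char_0) \<notin> \<int>"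
proof
  assume "inverse (of_nat p :: 'a) \<in> \<int>"
  then obtain n where "inverse (of_nat p :: 'a) = of_int n" by (elim Ints_cases)
  then have "of_int (n * int p) = (of_int 1 :: 'a)"
    using prime_gt_0_nat[OF assms] by (simp add: field_simps)
  then have "n * int p = 1" using of_int_eq_iff by blast
  then have "int p dvd 1" by (metis dvd_triv_right)
  then show False using assms not_prime_unit by auto
qed

text \<open>Zorn's lemma: the integers show that the family is nonempty, and unions of nonempty
  chains stay in it.\<close>

lemma maximal_subring_exists:
  assumes "prime p"
  obtains R :: "'a::field_char_0 set"
  where "is_subring R" "inverse (of_nat p) \<notin> R"
    "\<And>S. is_subring S \<Longrightarrow> R \<subseteq> S \<Longrightarrow> inverse (of_nat p) \<notin> S \<Longrightarrow> S = R"
proof -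
  let ?A = "{R :: 'a set. is_subring R \<and> inverse (of_nat p) \<notin> R}"
  have "\<exists>R\<in>?A. \<forall>S\<in>?A. R \<subseteq> S \<longrightarrow> S = R"
  proof (rule subset_Zorn_nonempty)
    have "(\<int> :: 'a set) \<in> ?A"
      using inverse_prime_not_Ints[OF assms] by (auto simp: is_subring_def)
    then show "?A \<noteq> {}" by blast
  next
    fix C assume C: "C \<noteq> {}" "subset.chain ?A C"
    have "is_subring (\<Union>C)"
      unfolding is_subring_def
    proof (intro conjI ballI)
      show "1 \<in> \<Union>C" using C by (force simp: subset.chain_def subring_1)
    next
      fix x y assume "x \<in> \<Union>C" "y \<in> \<Union>C"
      then obtain U W where UW: "x \<in> U" "U \<in> C" "y \<in> W" "W \<in> C" by blast
      moreover from UW C have "U \<subseteq> W \<or> W \<subseteq> U" "is_subring U" "is_subring W"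
        by (auto simp: subset.chain_def)
      ultimately obtain Z where Z: "x \<in> Z" "y \<in> Z" "Z \<in> C" "is_subring Z" by blast
      then show "x - y \<in> \<Union>C" "x * y \<in> \<Union>C"
        using subring_diff subring_mult by blast+
    qed
    then show "\<Union>C \<in> ?A" using C by (auto simp: subset.chain_def)
  qed
  then show ?thesis using that by blast
qed

section \<open>A maximal subring without \<open>1 / p\<close> is a valuation ring\<close>

locale max_subring =
  fixes p :: nat and R :: "'a::field_char_0 set"
  assumes prime: "prime p" and ring: "is_subring R" and p_inv: "inverse (of_nat p) \<notin> R"
    and maximal: "is_subring S \<Longrightarrow> R \<subseteq> S \<Longrightarrow> inverse (of_nat p) \<notin> S \<Longrightarrow> S = R"
begin

abbreviation P :: 'a where "P \<equiv> of_nat p"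

lemma p_nz [simp]: "p \<noteq> 0" using prime by auto

lemma P_nz: "P \<noteq> 0" by simp

lemmas R_simps = subring_0[OF ring] subring_1[OF ring] subring_diff[OF ring] subring_mult[OF ring]
  subring_add[OF ring] subring_minus[OF ring] subring_power[OF ring] subring_of_nat[OF ring]
  subring_of_int[OF ring]

lemma P_mult_neq_1: "x \<in> R \<Longrightarrow> P * x \<noteq> 1"
  using p_inv inverse_unique[of P x] by auto

text \<open>Localising \<open>R\<close> at \<open>1 - P * x\<close> does not create
  \<open>1 / P\<close>, since the powers of \<open>1 - P * x\<close> stay congruent to 1 modulo
  \<open>P * R\<close>. By maximality the localisation is \<open>R\<close> itself.\<close>

lemma inverse_1_minus:
  assumes "x \<in> R"
  shows "1 - P * x \<noteq> 0" "inverse (1 - P * x) \<in> R"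
proof -
  let ?d = "1 - P * x"
  show d: "?d \<noteq> 0" using P_mult_neq_1[OF assms] by simp
  have dR: "?d \<in> R" using assms by (simp add: R_simps)
  define S where "S = {y. \<exists>n. y * ?d ^ n \<in> R}"
  have "is_subring S"
    unfolding is_subring_def
  proof (intro conjI ballI)
    show "1 \<in> S" by (auto simp: S_def R_simps intro: exI[of _ 0])
    fix y z assume "y \<in> S" "z \<in> S"
    then obtain m n where mn: "y * ?d ^ m \<in> R" "z * ?d ^ n \<in> R" by (auto simp: S_def)
    have "(y * ?d ^ m) * ?d ^ n - (z * ?d ^ n) * ?d ^ m \<in> R"
      by (intro subring_diff[OF ring] subring_mult[OF ring mn(1)] subring_mult[OF ring mn(2)]
        subring_power[OF ring dR])
    then have "(y - z) * ?d ^ (m + n) \<in> R" by (simp add: algebra_simps power_add)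
    then show "y - z \<in> S" by (auto simp: S_def)
    have "(y * ?d ^ m) * (z * ?d ^ n) \<in> R" by (rule subring_mult[OF ring mn])
    then have "(y * z) * ?d ^ (m + n) \<in> R" by (simp add: algebra_simps power_add)
    then show "y * z \<in> S" by (auto simp: S_def)
  qed
  moreover have "R \<subseteq> S" by (auto simp: S_def intro!: exI[of _ 0])
  moreover have "inverse P \<notin> S"
  proof
    assume "inverse P \<in> S"
    then obtain n where n: "inverse P * ?d ^ n \<in> R" by (auto simp: S_def)
    have "\<exists>y\<in>R. ?d ^ n = 1 - P * y"
    proof (induction n)
      case 0 show ?case by (rule bexI[of _ 0]) (auto simp: R_simps)
    next
      case (Suc n)
      then obtain y where "y \<in> R" "?d ^ n = 1 - P * y" by blast
      then have "?d ^ Suc n = ?d * (1 - P * y)" by (simp only: power_Suc)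
      also have "\<dots> = 1 - P * (x + y - P * x * y)" by (simp add: algebra_simps)
      finally have "?d ^ Suc n = 1 - P * (x + y - P * x * y)" .
      moreover have "x + y - P * x * y \<in> R" using assms \<open>y \<in> R\<close> by (simp add: R_simps)
      ultimately show ?case by blast
    qed
    then obtain y where y: "y \<in> R" "?d ^ n = 1 - P * y" by blast
    then have "inverse P = inverse P * ?d ^ n + y" by (simp add: field_simps)
    then show False using p_inv n y by (metis subring_add[OF ring])
  qed
  ultimately have "S = R" by (rule maximal)
  moreover have "inverse ?d \<in> S" using d by (auto simp: S_def R_simps intro!: exI[of _ 1])
  ultimately show "inverse ?d \<in> R" by simp
qed

definition span :: "'a \<Rightarrow> nat \<Rightarrow> 'a set" where
  "span z n = {\<Sum>i<n. c i * z ^ i | c. \<forall>i. c i \<in> R}"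

lemma span_I: "(\<And>i. c i \<in> R) \<Longrightarrow> (\<Sum>i<n. c i * z ^ i) \<in> span z n"
  by (auto simp: span_def)

lemma span_add: assumes "x \<in> span z n" "y \<in> span z n" shows "x + y \<in> span z n"
proof -
  obtain c d where cd: "x = (\<Sum>i<n. c i * z ^ i)" "\<And>i. c i \<in> R" "y = (\<Sum>i<n. d i * z ^ i)" "\<And>i. d i \<in> R"
    using assms by (auto simp: span_def)
  have "x + y = (\<Sum>i<n. (c i + d i) * z ^ i)" using cd by (simp add: sum.distrib algebra_simps)
  then show ?thesis using cd by (auto simp: R_simps intro!: span_I)
qed

lemma span_scale: assumes "x \<in> span z n" "a \<in> R" shows "a * x \<in> span z n"
proof -
  obtain c where c: "x = (\<Sum>i<n. c i * z ^ i)" "\<And>i. c i \<in> R"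
    using assms by (auto simp: span_def)
  have "a * x = (\<Sum>i<n. (a * c i) * z ^ i)" using c by (simp add: sum_distrib_left algebra_simps)
  then show ?thesis using c assms by (auto simp: R_simps intro!: span_I)
qed

lemma span_power: assumes "i < n" shows "z ^ i \<in> span z n"
proof -
  have "z ^ i = (\<Sum>j<n. (if j = i then 1 else 0) * z ^ j)"
    using assms by (simp add: if_distrib[of "\<lambda>x. x * _"] cong: if_cong)
  also have "\<dots> \<in> span z n" by (rule span_I) (auto simp: R_simps)
  finally show ?thesis .
qed

lemma span_0: "0 \<in> span z n"
  using span_I[of "\<lambda>_. 0" z n] by (simp add: R_simps)

lemma span_sum: "(\<And>i. i \<in> A \<Longrightarrow> f i \<in> span z n) \<Longrightarrow> sum f A \<in> span z n"
  by (induction A rule: infinite_finite_induct) (auto simp: span_0 span_add)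

text \<open>Adjoining \<open>z\<close> properly enlarges \<open>R\<close>, so by maximality the
  larger ring contains \<open>1 / P\<close>.\<close>

lemma inverse_in_span:
  assumes "z \<notin> R" shows "\<exists>n. inverse P \<in> span z n"
proof -
  define S where "S = {poly q z | q. \<forall>i. coeff q i \<in> R}"
  have SI: "poly q z \<in> S" if "\<And>i. coeff q i \<in> R" for q using that by (auto simp: S_def)
  have "is_subring S"
    unfolding is_subring_def
  proof (intro conjI ballI)
    show "1 \<in> S" using SI[of 1] by (simp add: R_simps coeff_1)
    fix x y assume "x \<in> S" "y \<in> S"
    then obtain q r where qr: "x = poly q z" "\<And>i. coeff q i \<in> R" "y = poly r z" "\<And>i. coeff r i \<in> R"
      by (auto simp: S_def)
    show "x - y \<in> S" using SI[of "q - r"] qr by (simp add: R_simps)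
    show "x * y \<in> S" using SI[of "q * r"] qr
      by (simp add: R_simps coeff_mult subring_sum[OF ring])
  qed
  moreover have "R \<subseteq> S"
    using SI[of "[:_:]"] by (auto simp: coeff_pCons R_simps split: nat.splits)
  moreover have "z \<in> S" using SI[of "[:0, 1:]"] by (auto simp: coeff_pCons R_simps split: nat.splits)
  ultimately have "inverse P \<in> S" using maximal assms by blast
  then obtain q where q: "inverse P = poly q z" "\<And>i. coeff q i \<in> R" by (auto simp: S_def)
  then have "inverse P = (\<Sum>i<Suc (degree q). coeff q i * z ^ i)"
    by (simp add: poly_altdef lessThan_Suc_atMost)
  then show ?thesis using q span_I by metis
qed

text \<open>
  The unit \<open>1 - P * d 0\<close> allows the leading power \<open>z ^ n\<close> to be rewritten in terms of smaller powers.
\<close>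

lemma span_reduce:
  assumes "z \<noteq> 0" "inverse P \<in> span z (Suc n)" "inverse P \<in> span (inverse z) (Suc m)" "m \<le> n"
  shows "inverse P \<in> span z n"
proof -
  obtain c where c: "inverse P = (\<Sum>i<Suc n. c i * z ^ i)" "\<And>i. c i \<in> R"
    using assms(2) by (auto simp: span_def)
  obtain d where d: "inverse P = (\<Sum>i<Suc m. d i * inverse z ^ i)" "\<And>i. d i \<in> R"
    using assms(3) by (auto simp: span_def)
  let ?y = "\<Sum>i<m. d (Suc i) * z ^ (n - Suc i)"
  have "inverse P * z ^ n = (\<Sum>i<Suc m. d i * (inverse z ^ i * z ^ n))"
    by (subst d(1)) (simp add: sum_distrib_right mult.assoc del: sum.lessThan_Suc)
  also have "\<dots> = (\<Sum>i<Suc m. d i * z ^ (n - i))"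
    using assms(1,4) by (intro sum.cong) (auto simp: power_diff power_inverse divide_inverse mult.commute)
  also have "\<dots> = d 0 * z ^ n + ?y"
    by (subst sum.lessThan_Suc_shift) simp
  finally have "P * (inverse P * z ^ n) = P * (d 0 * z ^ n + ?y)" by simp
  then have "(1 - P * d 0) * z ^ n = P * ?y"
    by (metis (no_types, lifting) P_nz add_diff_cancel_left' distrib_left left_diff_distrib
        mult.assoc mult_1 right_inverse)
  moreover have "?y \<in> span z n"
    using assms(4) d(2) by (intro span_sum span_scale span_power) auto
  ultimately have "z ^ n = inverse (1 - P * d 0) * (P * ?y)"
    using inverse_1_minus(1)[of "d 0"] d(2) by (simp add: field_simps)
  moreover have "inverse (1 - P * d 0) * (P * ?y) \<in> span z n"
    using \<open>?y \<in> span z n\<close> d(2) inverse_1_minus(2) by (intro span_scale) (auto simp: R_simps)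
  ultimately have "c n * z ^ n \<in> span z n" using c(2) span_scale by metis
  moreover have "inverse P = (\<Sum>i<n. c i * z ^ i) + c n * z ^ n" using c(1) by simp
  ultimately show ?thesis using span_add span_I c(2) by metis
qed

text \<open>Chevalley's argument: otherwise there are shortest expressions of \<open>1 / P\<close>
  as polynomials in \<open>z\<close> and in \<open>inverse z\<close>, and \<open>span_reduce\<close>
  shortens one that is at least as long as the other.\<close>

lemma valuation_ring:
  assumes "z \<noteq> 0" shows "z \<in> R \<or> inverse z \<in> R"
proof (rule ccontr)
  assume *: "\<not> ?thesis"
  define n where "n = (LEAST n. inverse P \<in> span z n)"
  define m where "m = (LEAST n. inverse P \<in> span (inverse z) n)"
  have n: "inverse P \<in> span z n" "\<And>k. k < n \<Longrightarrow> inverse P \<notin> span z k"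
    using inverse_in_span[of z] * unfolding n_def by (auto intro: LeastI_ex dest: not_less_Least)
  have m: "inverse P \<in> span (inverse z) m" "\<And>k. k < m \<Longrightarrow> inverse P \<notin> span (inverse z) k"
    using inverse_in_span[of "inverse z"] * unfolding m_def
    by (auto intro: LeastI_ex dest: not_less_Least)
  have "inverse P \<notin> span w 0" for w by (simp add: span_def)
  then obtain n' m' where nm: "n = Suc n'" "m = Suc m'" using n(1) m(1) by (metis not0_implies_Suc)
  show False
  proof (cases "m' \<le> n'")
    case True
    then show False using span_reduce[of z n' m'] assms n m nm by simp
  next
    case False
    then show False using span_reduce[of "inverse z" m' n'] assms n m nm by simp
  qed
qed

section \<open>Units of the valuation ring and rational values of field elements\<close>

definition unit :: "'a \<Rightarrow> bool" where
  "unit x \<longleftrightarrow> x \<noteq> 0 \<and> x \<in> R \<and> inverse x \<in> R"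

lemma unit_mult: "unit x \<Longrightarrow> unit y \<Longrightarrow> unit (x * y)"
  and unit_inverse: "unit x \<Longrightarrow> unit (inverse x)"
  and unit_1: "unit 1"
  by (auto simp: unit_def R_simps)

lemma unit_power: "unit x \<Longrightarrow> unit (x ^ n)"
  by (induction n) (auto simp: unit_1 unit_mult)

lemma unit_divide: "unit x \<Longrightarrow> unit y \<Longrightarrow> unit (x / y)"
  by (simp add: divide_inverse unit_mult unit_inverse)

text \<open>One of \<open>x / y\<close> and \<open>y / x\<close> lies in \<open>R\<close>, so the
  sum is one summand times an element of \<open>R\<close>; if the sum were invertible, so would be
  that summand.\<close>

lemma nonunit_add:
  assumes "x \<in> R" "y \<in> R" "\<not> unit x" "\<not> unit y" shows "\<not> unit (x + y)"
proof -
  have *: "\<not> unit (x + y)" if "y \<in> R" "\<not> unit y" "y \<noteq> 0" "x / y \<in> R" for x y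
  proof
    assume "unit (x + y)"
    then have "inverse (x + y) * (1 + x / y) \<in> R" using that by (auto simp: unit_def R_simps)
    moreover have "inverse (x + y) * (1 + x / y) = inverse y"
      using that \<open>unit (x + y)\<close> by (simp add: unit_def field_simps)
    ultimately show False using that by (simp add: unit_def)
  qed
  show ?thesis
  proof (cases "x = 0 \<or> y = 0")
    case False
    then have "x / y \<in> R \<or> y / x \<in> R" using valuation_ring[of "x / y"] by auto
    then show ?thesis using *[of y x] *[of x y] False assms by (auto simp: add.commute)
  qed (use assms in auto)
qed

lemma nonunit_sum:
  "(\<And>i. i \<in> A \<Longrightarrow> f i \<in> R \<and> \<not> unit (f i)) \<Longrightarrow> \<not> unit (sum f A)"
proof (induction A rule: infinite_finite_induct)
  case (insert i A)
  then show ?case using nonunit_add[of "f i" "sum f A"] subring_sum[OF ring, of A f] by simp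
qed (auto simp: unit_def)

text \<open>Bezout's identity gives \<open>a * n = 1 - p * b\<close>, and the right-hand side is
  invertible by \<open>inverse_1_minus\<close>.\<close>

lemma unit_of_int:
  assumes "\<not> int p dvd n" shows "unit (of_int n)"
proof -
  have "coprime n (int p)"
    using assms prime by (metis coprime_commute prime_imp_coprime prime_nat_int_transfer)
  then obtain a b where ab: "a * n + b * int p = 1" using bezout_int[of n "int p"] by auto
  have "of_int a * of_int n = (1 - P * of_int b :: 'a)"
  proof -
    have "of_int (a * n + b * int p) = (1 :: 'a)" using ab by simp
    then show ?thesis by (simp add: algebra_simps)
  qed
  moreover have "of_int n \<noteq> (0::'a)" using assms by (cases "n = 0") auto
  ultimately have "inverse (of_int n) = of_int a * inverse (1 - P * of_int b :: 'a)" and "of_int n \<noteq> (0::'a)"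
    using inverse_1_minus(1)[of "of_int b"] by (auto simp: R_simps divide_simps)
  then show ?thesis using inverse_1_minus(2)[of "of_int b"] by (auto simp: unit_def R_simps)
qed

lemma unit_of_int_factor:
  assumes "n \<noteq> 0" shows "unit (of_int n / P ^ multiplicity (int p) n)"
proof -
  have "prime (int p)" using prime by simp
  then obtain m where m: "n = int p ^ multiplicity (int p) n * m" "\<not> int p dvd m"
    using multiplicity_decompose'[of n "int p"] assms by (metis not_prime_unit)
  have "of_int n = (P ^ multiplicity (int p) n * of_int m :: 'a)"
    by (subst m(1)) simp
  then show ?thesis using unit_of_int[OF m(2)] by simp
qed

lemma P_not_unit: "0 < k \<Longrightarrow> \<not> unit (P ^ k)"
proof
  assume "0 < k" "unit (P ^ k)"
  then obtain j where "k = Suc j" by (cases k) auto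
  then have "P ^ j * inverse (P ^ k) = inverse P" by (simp add: field_simps)
  then show False using \<open>unit (P ^ k)\<close> p_inv R_simps by (metis unit_def)
qed

text \<open>The value is read off a power of \<open>x\<close> that is a power of \<open>P\<close> up
  to a unit. This normalises \<open>P\<close> to value 1 and avoids an abstract value group.\<close>

definition has_val :: "'a \<Rightarrow> real \<Rightarrow> bool" where
  "has_val x r \<longleftrightarrow> (\<exists>n a. n > 0 \<and> r = real_of_int a / real n \<and> unit (x ^ n / P powi a))"

lemma has_val_mult:
  assumes "has_val x r" "has_val y s" shows "has_val (x * y) (r + s)"
proof -
  obtain n a m b where *: "n > 0" "r = real_of_int a / real n" "unit (x ^ n / P powi a)"
    "m > 0" "s = real_of_int b / real m" "unit (y ^ m / P powi b)"
    using assms by (auto simp: has_val_def)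
  have "unit ((x ^ n / P powi a) ^ m * (y ^ m / P powi b) ^ n)"
    using * by (intro unit_mult unit_power)
  also have "(x ^ n / P powi a) ^ m * (y ^ m / P powi b) ^ n
      = (x * y) ^ (n * m) / P powi (a * int m + b * int n)"
    by (simp add: power_mult_distrib power_divide power_int_add power_int_power' mult.commute
        flip: power_mult)
  finally show ?thesis
    unfolding has_val_def using *
    by (intro exI[of _ "n * m"] exI[of _ "a * int m + b * int n"]) (auto simp: field_simps)
qed

lemma has_val_inverse:
  assumes "has_val x r" shows "has_val (inverse x) (- r)"
proof -
  obtain n a where *: "n > 0" "r = real_of_int a / real n" "unit (x ^ n / P powi a)"
    using assms by (auto simp: has_val_def)
  have "inverse (x ^ n / P powi a) = inverse x ^ n / P powi (- a)"
    by (simp add: power_int_minus power_inverse field_simps)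
  then show ?thesis unfolding has_val_def using * unit_inverse[OF *(3)]
    by (intro exI[of _ n] exI[of _ "- a"]) auto
qed

lemma has_val_nonneg:
  assumes "has_val x r" "x \<in> R" shows "0 \<le> r"
proof (rule ccontr)
  assume "\<not> 0 \<le> r"
  moreover obtain n a where *: "n > 0" "r = real_of_int a / real n" "unit (x ^ n / P powi a)"
    using assms by (auto simp: has_val_def)
  ultimately have a: "a < 0" by (auto simp: zero_le_divide_iff)
  have "x ^ n / P powi a = x ^ n * P ^ nat (- a)"
    using a by (simp add: power_int_def field_simps)
  then have u: "unit (x ^ n * P ^ nat (- a))" using * by simp
  have "inverse (P ^ nat (- a)) = inverse (x ^ n * P ^ nat (- a)) * x ^ n"
    using u by (simp add: unit_def)
  then have "inverse (P ^ nat (- a)) \<in> R" using u assms(2) by (metis R_simps(4,7) unit_def)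
  then have "unit (P ^ nat (- a))" by (simp add: unit_def R_simps)
  then show False using P_not_unit[of "nat (- a)"] a by simp
qed

text \<open>If \<open>x\<close> were outside \<open>R\<close>, then \<open>inverse x\<close> would
  lie in \<open>R\<close> and \<open>r\<close> would be 0, so some \<open>x ^ n\<close> would be a
  unit; but \<open>x = x ^ n * inverse x ^ (n - 1)\<close>.\<close>

lemma has_val_nonneg_imp:
  assumes "has_val x r" "0 \<le> r" shows "x \<in> R"
proof (rule ccontr)
  assume "x \<notin> R"
  then have i: "inverse x \<in> R" "x \<noteq> 0" using valuation_ring[of x] R_simps(1) by auto
  then have "r = 0" using has_val_nonneg[OF has_val_inverse[OF assms(1)]] assms(2) by simp
  then obtain n where n: "n > 0" "unit (x ^ n)" using assms(1) by (auto simp: has_val_def)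
  have "x ^ n * inverse x ^ (n - 1) \<in> R" using n i by (auto simp: unit_def R_simps)
  moreover have "x ^ n * inverse x ^ (n - 1) = x"
    using n i by (cases n) (auto simp: power_inverse)
  ultimately show False using \<open>x \<notin> R\<close> by simp
qed

lemma has_val_unique:
  assumes "has_val x r" "has_val x s" "x \<noteq> 0" shows "r = s"
proof -
  have "has_val 1 (r + - s)" "has_val 1 (s + - r)"
    using has_val_mult[OF assms(1) has_val_inverse[OF assms(2)]]
      has_val_mult[OF assms(2) has_val_inverse[OF assms(1)]] assms(3) by auto
  from this[THEN has_val_nonneg, OF R_simps(2)] show ?thesis by simp
qed

lemma has_val_of_int:
  assumes "n \<noteq> 0" shows "has_val (of_int n) (real (multiplicity (int p) n))"
  unfolding has_val_def using unit_of_int_factor[OF assms]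
  by (intro exI[of _ 1] exI[of _ "int (multiplicity (int p) n)"]) auto

text \<open>Newton polygon argument: in the vanishing sum of the terms
  \<open>coeff q i * x ^ i\<close>, two different terms agree up to a unit. Nonzero coefficients are
  powers of \<open>P\<close> up to units, hence so is a positive power of \<open>x\<close>.\<close>

lemma has_val_exists:
  assumes "x \<noteq> 0" "q \<noteq> 0" "poly (map_poly of_int q) x = 0"
  shows "\<exists>r. has_val x r"
proof -
  let ?t = "\<lambda>i. of_int (coeff q i) * x ^ i"
  define A where "A = {i. i \<le> degree q \<and> coeff q i \<noteq> 0}"
  have A: "finite A" "A \<noteq> {}" using assms(2) by (auto simp: A_def)
  have nz: "?t i \<noteq> 0" if "i \<in> A" for i using that assms(1) by (auto simp: A_def)
  \<comment> \<open>A term of least value, found by comparing terms pairwise in the valuation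
    ring.\<close>
  have "\<exists>i\<in>A. \<forall>j\<in>A. ?t j / ?t i \<in> R"
    using A nz
  proof (induction A rule: finite_ne_induct)
    case (insert k A)
    then obtain i where i: "i \<in> A" "\<And>j. j \<in> A \<Longrightarrow> ?t j / ?t i \<in> R" by auto
    show ?case
    proof (cases "?t k / ?t i \<in> R")
      case True
      then show ?thesis using i by auto
    next
      case False
      then have "?t i / ?t k \<in> R"
        using valuation_ring[of "?t k / ?t i"] R_simps(1) insert.prems by (metis inverse_divide)
      moreover have "?t j / ?t k = (?t j / ?t i) * (?t i / ?t k)" if "j \<in> A" for j
        using insert.prems i(1) by simp
      ultimately have "\<forall>j\<in>A. ?t j / ?t k \<in> R" using i R_simps(4) by metis
      moreover have "?t k / ?t k \<in> R" using insert.prems[of k] by (simp add: R_simps)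
      ultimately show ?thesis by blast
    qed
  qed (simp add: R_simps)
  then obtain i where i: "i \<in> A" "\<And>j. j \<in> A \<Longrightarrow> ?t j / ?t i \<in> R" by blast
  have deg: "degree (map_poly of_int q :: 'a poly) = degree q"
    by (rule map_poly_degree_eq) (use assms(2) in auto)
  have "(\<Sum>j\<in>A. ?t j) = poly (map_poly of_int q) x"
    unfolding poly_altdef using deg
    by (intro sum.mono_neutral_cong_left) (auto simp: A_def coeff_map_poly)
  then have "0 = (\<Sum>j\<in>A. ?t j / ?t i)" using assms(3) by (simp flip: sum_divide_distrib)
  also have "\<dots> = 1 + (\<Sum>j\<in>A - {i}. ?t j / ?t i)" using i(1) A nz by (simp add: sum.remove)
  finally have "(\<Sum>j\<in>A - {i}. ?t j / ?t i) = - 1" by (simp add: eq_neg_iff_add_eq_0 add.commute)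
  moreover have "unit (- 1)" by (simp add: unit_def R_simps)
  \<comment> \<open>The remaining quotients sum to the unit \<open>- 1\<close>, so by
    \<open>nonunit_sum\<close> they are not all nonunits.\<close>
  ultimately obtain j where j: "j \<in> A" "j \<noteq> i" "unit (?t j / ?t i)"
    using nonunit_sum[of "A - {i}" "\<lambda>j. ?t j / ?t i"] i by (metis DiffE insertI1)
  have *: "\<exists>r. has_val x r" if "j \<in> A" "i \<in> A" "i < j" "unit (?t j / ?t i)" for i j
  proof -
    let ?m = "\<lambda>i. multiplicity (int p) (coeff q i)"
    have nz: "of_int (coeff q i) \<noteq> (0 :: 'a)" "of_int (coeff q j) \<noteq> (0 :: 'a)"
      using that by (auto simp: A_def)
    have "unit (?t j / ?t i * (of_int (coeff q i) / P ^ ?m i) / (of_int (coeff q j) / P ^ ?m j))"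
      by (rule unit_divide[OF unit_mult[OF that(4) unit_of_int_factor] unit_of_int_factor])
        (use nz in auto)
    also have "?t j / ?t i * (of_int (coeff q i) / P ^ ?m i) / (of_int (coeff q j) / P ^ ?m j)
        = x ^ (j - i) / P powi (int (?m i) - int (?m j))"
      using that(3) assms(1) nz by (simp add: power_diff power_int_diff field_simps)
    finally show ?thesis using that unfolding has_val_def
      by (intro exI conjI) (auto simp: zero_less_diff)
  qed
  have "unit (?t i / ?t j)" using unit_inverse[OF j(3)] by simp
  then show ?thesis using *[of i j] *[of j i] i j by (cases "i < j") auto
qed

end

text \<open>Values are real, so \<open>v 0\<close> cannot be infinite; it is left unspecified, hence
  the conditions on 0.\<close>

locale padic_val =
  fixes p :: nat and v :: "'a::field_char_0 \<Rightarrow> real"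
  assumes prime: "prime p"
    and v_mult: "x \<noteq> 0 \<Longrightarrow> y \<noteq> 0 \<Longrightarrow> v (x * y) = v x + v y"
    and v_add: "x \<noteq> 0 \<Longrightarrow> y \<noteq> 0 \<Longrightarrow> x + y \<noteq> 0 \<Longrightarrow> min (v x) (v y) \<le> v (x + y)"
    and v_int: "n \<noteq> 0 \<Longrightarrow> v (of_int n) = real (multiplicity (int p) n)"

text \<open>Uniqueness of values gives multiplicativity. For the ultrametric inequality the summand
  \<open>x\<close> of smaller value is factored out; the cofactor \<open>1 + y / x\<close> lies in
  \<open>R\<close>.\<close>

lemma padic_val_exists:
  assumes "prime p" and alg: "\<And>x::'a::field_char_0. algebraic x"
  shows "\<exists>v :: 'a \<Rightarrow> real. padic_val p v"
proof -
  obtain R :: "'a set" where "is_subring R" "inverse (of_nat p) \<notin> R"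
    "\<And>S. is_subring S \<Longrightarrow> R \<subseteq> S \<Longrightarrow> inverse (of_nat p) \<notin> S \<Longrightarrow> S = R"
    using maximal_subring_exists[OF assms(1)] by blast
  then interpret max_subring p R using assms(1) by unfold_locales
  have "\<exists>r. has_val x r" if "x \<noteq> 0" for x
    using has_val_exists[OF that] algebraicE'[OF alg[of x]] by metis
  then obtain v where v: "\<And>x. x \<noteq> 0 \<Longrightarrow> has_val x (v x)" by metis
  have mult: "v (x * y) = v x + v y" if "x \<noteq> 0" "y \<noteq> 0" for x y
    using has_val_unique[OF v has_val_mult[OF v v]] that by simp
  have add: "v x \<le> v (x + y)" if "x \<noteq> 0" "y \<noteq> 0" "x + y \<noteq> 0" "v x \<le> v y" for x y
  proof -
    have eq: "x + y = x * (1 + y / x)" "y = x * (y / x)" using that by (auto simp: field_simps)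
    then have nz: "y / x \<noteq> 0" "1 + y / x \<noteq> 0" using that by auto
    have "0 \<le> v (y / x)" using mult[OF that(1) nz(1)] that(4) eq(2) by simp
    then have "y / x \<in> R" using has_val_nonneg_imp[OF v[OF nz(1)]] by simp
    then have "0 \<le> v (1 + y / x)" using has_val_nonneg[OF v[OF nz(2)]] by (simp add: R_simps)
    then show ?thesis using mult[OF that(1) nz(2)] eq(1) by simp
  qed
  have "padic_val p v"
  proof
    show "v (of_int n) = real (multiplicity (int p) n)" if "n \<noteq> 0" for n
      using has_val_unique[OF v has_val_of_int[OF that]] that by simp
    show "min (v x) (v y) \<le> v (x + y)" if "x \<noteq> 0" "y \<noteq> 0" "x + y \<noteq> 0" for x y
      using add[of x y] add[of y x] that by (cases "v x \<le> v y") (auto simp: add.commute)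
  qed (use assms(1) mult in auto)
  then show ?thesis by blast
qed

section \<open>Potentials and energy on the tree of residue classes\<close>

lemma sum_le_single_support:
  fixes f :: "'c \<Rightarrow> real"
  assumes "finite A" "\<And>c d. c \<in> A \<Longrightarrow> d \<in> A \<Longrightarrow> f c \<noteq> 0 \<Longrightarrow> f d \<noteq> 0 \<Longrightarrow> c = d"
    and "\<And>c. c \<in> A \<Longrightarrow> f c \<le> B" "0 \<le> B"
  shows "sum f A \<le> B"
proof (cases "\<exists>c\<in>A. f c \<noteq> 0")
  case True
  then obtain c where c: "c \<in> A" "f c \<noteq> 0" by blast
  have "sum f A = sum f {c}"
    by (rule sum.mono_neutral_right) (use assms(1,2) c in auto)
  then show ?thesis using assms(3) c by simp
next
  case False
  then show ?thesis using assms(4) by simp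
qed

section \<open>Geometric sums and the potential of one family of roots\<close>

definition geom :: "nat \<Rightarrow> nat \<Rightarrow> nat" where
  "geom p l = (\<Sum>i<l. p ^ i)"

lemma geom_0 [simp]: "geom p 0 = 0"
  and geom_Suc [simp]: "geom p (Suc l) = geom p l + p ^ l"
  by (simp_all add: geom_def)

text \<open>For \<open>p > 0\<close> this is \<open>1 / p + ... + 1 / p ^ l\<close>; its reciprocal
  becomes the factor of \<open>s1 * s2\<close> in the bound.\<close>

definition geom_ratio :: "nat \<Rightarrow> nat \<Rightarrow> real" where
  "geom_ratio p l = real (geom p l) / real p ^ l"

lemma geom_ratio_0 [simp]: "geom_ratio p 0 = 0"
  by (simp add: geom_ratio_def)

lemma geom_ratio_nonneg [simp]: "0 \<le> geom_ratio p l"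
  by (simp add: geom_ratio_def)

lemma geom_ratio_Suc: "p > 0 \<Longrightarrow> real p * geom_ratio p (Suc l) = 1 + geom_ratio p l"
  by (simp add: geom_ratio_def field_simps)

text \<open>
  Here \<open>x i n\<close> stands for \<open>v (\<alpha>\<^sub>i - n)\<close> truncated at a large depth \<open>D\<close>, which keeps everything real
  valued even if \<open>n\<close> is a root.
\<close>

locale potential_tree =
  fixes p D :: nat and I :: "'i set" and x :: "'i \<Rightarrow> int \<Rightarrow> real"
  assumes p_pos: "p > 0" and fin: "finite I"
    and nonneg: "i \<in> I \<Longrightarrow> 0 \<le> x i n"
    and cong: "i \<in> I \<Longrightarrow> k \<le> D \<Longrightarrow> int p ^ k dvd n - m \<Longrightarrow> min (x i n) (real k) = min (x i m) (real k)"
    and sep: "i \<in> I \<Longrightarrow> x i n > real k \<Longrightarrow> x i m > real k \<Longrightarrow> int p ^ Suc k dvd n - m"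
    and integral: "k \<le> D \<Longrightarrow> (\<Sum>i\<in>I. min (x i n) (real k)) \<in> \<int>"
begin

text \<open>
  \<open>Phi k n\<close> is the potential collected from depth \<open>0\<close> to depth \<open>k\<close> on the path to \<open>n\<close>, \<open>M k n\<close> is the
  part collected on the edge from depth \<open>k\<close> to \<open>k + 1\<close>, and \<open>N k n\<close> is the set of roots lying in the
  disc of the residue class of \<open>n\<close> modulo \<open>p ^ k\<close>.
\<close>

definition Phi :: "nat \<Rightarrow> int \<Rightarrow> real" where
  "Phi k n = (\<Sum>i\<in>I. min (x i n) (real k))"

definition N :: "nat \<Rightarrow> int \<Rightarrow> 'i set" where
  "N k n = {i\<in>I. real k \<le> x i n}"

text \<open>The share of the single root \<open>i\<close> in \<open>M k n\<close>.\<close>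

definition mu :: "nat \<Rightarrow> 'i \<Rightarrow> int \<Rightarrow> real" where
  "mu k i n = min (x i n) (real (Suc k)) - min (x i n) (real k)"

definition M :: "nat \<Rightarrow> int \<Rightarrow> real" where
  "M k n = Phi (Suc k) n - Phi k n"

definition residual_ge :: "nat \<Rightarrow> int \<Rightarrow> real \<Rightarrow> bool" where
  "residual_ge k a s \<longleftrightarrow> (\<forall>n. int p ^ k dvd n - a \<longrightarrow> s \<le> Phi D n - Phi k n)"

lemma Phi_Ints: "k \<le> D \<Longrightarrow> Phi k n \<in> \<int>"
  unfolding Phi_def by (rule integral)

lemma M_Ints: "k < D \<Longrightarrow> M k n \<in> \<int>"
  unfolding M_def by (intro Ints_diff Phi_Ints) auto

lemma finite_N [simp]: "finite (N k n)"
  using fin by (simp add: N_def)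

lemma mu_nonneg: "0 \<le> mu k i n" and mu_le_1: "mu k i n \<le> 1"
  and mu_eq_0: "x i n \<le> real k \<Longrightarrow> mu k i n = 0"
  and mu_eq: "real k \<le> x i n \<Longrightarrow> mu k i n = min (x i n - real k) 1"
  by (auto simp: mu_def)

lemma M_eq: "M k n = (\<Sum>i\<in>I. mu k i n)"
  by (simp add: M_def Phi_def mu_def sum_subtractf)

lemma M_nonneg: "0 \<le> M k n"
  unfolding M_eq by (intro sum_nonneg mu_nonneg)

lemma Phi_mono: "j \<le> k \<Longrightarrow> Phi j n \<le> Phi k n"
  unfolding Phi_def by (intro sum_mono) auto

text \<open>A root in the disc of the child has passed the whole edge and contributes exactly 1 to
  it.\<close>

lemma card_N_le_M: "real (card (N (Suc k) n)) \<le> M k n"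
proof -
  have "real (card (N (Suc k) n)) = (\<Sum>i\<in>N (Suc k) n. mu k i n)"
    by (simp add: N_def mu_def)
  also have "\<dots> \<le> M k n"
    unfolding M_eq by (rule sum_mono2) (auto simp: fin N_def mu_nonneg)
  finally show ?thesis .
qed

lemma Phi_cong: "k \<le> D \<Longrightarrow> int p ^ k dvd n - m \<Longrightarrow> Phi k n = Phi k m"
  unfolding Phi_def by (intro sum.cong cong) auto

lemma residual_ge_Suc:
  assumes "k < D" "residual_ge k a s"
  shows "residual_ge (Suc k) a (s - M k a)"
  unfolding residual_ge_def
proof (intro allI impI)
  fix n assume n: "int p ^ Suc k dvd n - a"
  then have n': "int p ^ k dvd n - a"
    using dvd_trans[of "int p ^ k" "int p ^ Suc k"] by (simp add: le_imp_power_dvd)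
  have "s \<le> Phi D n - Phi k n" using assms(2) n' by (auto simp: residual_ge_def)
  moreover have "Phi k n = Phi k a" "Phi (Suc k) n = Phi (Suc k) a"
    using assms(1) n n' by (auto intro: Phi_cong)
  ultimately show "s - M k a \<le> Phi D n - Phi (Suc k) n" by (simp add: M_def)
qed

lemma residual_ge_child:
  assumes "residual_ge k a s" shows "residual_ge k (a + int c * int p ^ k) s"
  unfolding residual_ge_def
proof (intro allI impI)
  fix n assume "int p ^ k dvd n - (a + int c * int p ^ k)"
  then have "int p ^ k dvd (n - (a + int c * int p ^ k)) + int c * int p ^ k"
    by (intro dvd_add) auto
  then show "s \<le> Phi D n - Phi k n" using assms by (simp add: residual_ge_def)
qed

lemma residual_ge_self: "residual_ge k a s \<Longrightarrow> s \<le> Phi D a - Phi k a"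
  by (simp add: residual_ge_def)

lemma residual_ge_mono: "residual_ge k a s \<Longrightarrow> s' \<le> s \<Longrightarrow> residual_ge k a s'"
  by (force simp: residual_ge_def)

lemma residual_ge_0: "k \<le> D \<Longrightarrow> residual_ge k a 0"
  by (simp add: residual_ge_def Phi_mono)

lemma child_unique:
  assumes "i \<in> I" "c < p" "d < p"
    and "x i (a + int c * int p ^ k) > real k" "x i (a + int d * int p ^ k) > real k"
  shows "c = d"
proof -
  have "int p ^ Suc k dvd (a + int c * int p ^ k) - (a + int d * int p ^ k)"
    using sep assms by blast
  then have "int p ^ k * int p dvd int p ^ k * (int c - int d)"
    by (simp add: algebra_simps)
  then have *: "int p dvd int c - int d"
    using p_pos by simp
  show ?thesis
  proof (rule ccontr)
    assume "c \<noteq> d"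
    then have "int p \<le> \<bar>int c - int d\<bar>"
      using dvd_imp_le_int[OF _ *] by simp
    with assms(2,3) show False by linarith
  qed
qed

lemma x_child:
  assumes "i \<in> I" "k \<le> D"
  shows "real k \<le> x i (a + int c * int p ^ k) \<longleftrightarrow> real k \<le> x i a"
  using cong[OF assms, of "a + int c * int p ^ k" a] by (auto simp: min_def split: if_splits)

text \<open>After exchanging the sums, each root contributes to at most one child edge by
  \<open>child_unique\<close>, at most 1 there, and nothing if it lies outside the disc of
  \<open>a\<close>.\<close>

lemma sum_M_le:
  assumes "k \<le> D"
  shows "(\<Sum>c<p. M k (a + int c * int p ^ k)) \<le> real (card (N k a))"
proof -
  have "(\<Sum>c<p. M k (a + int c * int p ^ k)) = (\<Sum>i\<in>I. \<Sum>c<p. mu k i (a + int c * int p ^ k))"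
    unfolding M_eq by (rule sum.swap)
  also have "\<dots> \<le> (\<Sum>i\<in>I. if real k \<le> x i a then 1 else 0)"
  proof (rule sum_mono)
    fix i assume i: "i \<in> I"
    show "(\<Sum>c<p. mu k i (a + int c * int p ^ k)) \<le> (if real k \<le> x i a then 1 else 0)"
    proof (rule sum_le_single_support)
      fix c d assume "c \<in> {..<p}" "d \<in> {..<p}"
        "mu k i (a + int c * int p ^ k) \<noteq> 0" "mu k i (a + int d * int p ^ k) \<noteq> 0"
      then show "c = d" 
        using child_unique[OF i, of c d k a] mu_eq_0[of i "a + int c * int p ^ k" k]
          mu_eq_0[of i "a + int d * int p ^ k" k] by force
    next
      fix c
      show "mu k i (a + int c * int p ^ k) \<le> (if real k \<le> x i a then 1 else 0)"
        using x_child[OF i assms, of a c] mu_le_1[of k i "a + int c * int p ^ k"]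
          mu_eq_0[of i "a + int c * int p ^ k" k]
        by (auto simp: not_le)
    qed auto
  qed
  also have "\<dots> = real (card (N k a))"
    by (simp add: N_def sum.If_cases fin Int_def)
  finally show ?thesis .
qed

text \<open>Each of the \<open>p\<close> child edges carries at least \<open>p ^ l\<close>, and
  \<open>sum_M_le\<close> bounds their total by the number of roots.\<close>

lemma mass_large:
  assumes "k \<le> D" "residual_ge k a (real (geom p (Suc l)))"
  shows "real p ^ Suc l \<le> real (card (N k a))"
  using assms
proof (induction l arbitrary: k a)
  case (0 k a)
  have "k < D"
  proof (rule ccontr)
    assume "\<not> k < D"
    then show False using 0 residual_ge_self[OF 0(2)] by auto
  qed
  \<comment> \<open>Either no root reaches the child, and all the remaining potential is collected
    on this edge, or some root reaches it and alone contributes 1.\<close>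
  have "1 \<le> M k (a + int c * int p ^ k)" for c
  proof (cases "N (Suc k) (a + int c * int p ^ k) = {}")
    case True
    let ?b = "a + int c * int p ^ k"
    have "Phi D ?b = Phi (Suc k) ?b"
      unfolding Phi_def using True \<open>k < D\<close> by (intro sum.cong) (auto simp: N_def)
    then show ?thesis
      using residual_ge_self[OF residual_ge_child[OF 0(2)], of c] by (simp add: M_def)
  next
    case False
    then have "1 \<le> card (N (Suc k) (a + int c * int p ^ k))"
      by (simp add: Suc_leI card_gt_0_iff)
    then show ?thesis using card_N_le_M[of k "a + int c * int p ^ k"] by linarith
  qed
  then have "(\<Sum>c<p. 1) \<le> (\<Sum>c<p. M k (a + int c * int p ^ k))"
    by (intro sum_mono) auto
  also have "\<dots> \<le> real (card (N k a))" using sum_M_le 0 by blast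
  finally show ?case by simp
next
  case (Suc l k a)
  have "k < D"
  proof (rule ccontr)
    assume "\<not> k < D"
    then have "real (geom p (Suc (Suc l))) \<le> 0" using Suc residual_ge_self[OF Suc(3)] by auto
    moreover have "0 < real p ^ Suc l" "0 \<le> real p ^ l" using p_pos by simp_all
    ultimately show False unfolding geom_Suc of_nat_add of_nat_power by linarith
  qed
  \<comment> \<open>An edge carrying less would leave at least \<open>geom p (Suc l)\<close> below
    the child, hence by induction \<open>p ^ Suc l\<close> roots there, each contributing 1 to this
    very edge.\<close>
  have "real p ^ Suc l \<le> M k (a + int c * int p ^ k)" for c
  proof (rule ccontr)
    let ?b = "a + int c * int p ^ k"
    assume "\<not> ?thesis"
    moreover have "residual_ge (Suc k) ?b (real (geom p (Suc (Suc l))) - M k ?b)"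
      using Suc(3) \<open>k < D\<close> by (intro residual_ge_Suc residual_ge_child)
    ultimately have "residual_ge (Suc k) ?b (real (geom p (Suc l)))"
      by (elim residual_ge_mono) simp
    with \<open>\<not> ?thesis\<close> show False
      using Suc.IH[of "Suc k" ?b] \<open>k < D\<close> card_N_le_M[of k ?b] by simp
  qed
  then have "(\<Sum>c<p. real p ^ Suc l) \<le> (\<Sum>c<p. M k (a + int c * int p ^ k))"
    by (intro sum_mono) auto
  also have "\<dots> \<le> real (card (N k a))" using sum_M_le Suc by blast
  finally show ?case by simp
qed

text \<open>If at least \<open>geom p (Suc l)\<close> were left, \<open>mass_large\<close> would put
  \<open>p ^ Suc l\<close> roots below the edge and as much potential on it, and \<open>s\<close>
  would reach \<open>geom p (Suc (Suc l))\<close>.\<close>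

lemma level_drop:
  assumes "k < D" "residual_ge k a s" "s < real (geom p (Suc (Suc l)))"
  shows "s - M k a < real (geom p (Suc l))"
proof (rule ccontr)
  assume *: "\<not> ?thesis"
  then have "residual_ge (Suc k) a (real (geom p (Suc l)))"
    using residual_ge_Suc[OF assms(1,2)] by (elim residual_ge_mono) simp
  then have "real p ^ Suc l \<le> M k a"
    using mass_large[of "Suc k" a l] assms(1) card_N_le_M[of k a] by simp
  with * assms(3) show False by simp
qed

text \<open>By induction below each child, \<open>s\<close> is at most
  \<open>1 + geom_ratio p l\<close> times the potential of the child edge; summing over the
  \<open>p\<close> children gives the recursion of \<open>geom_ratio_Suc\<close>.\<close>

lemma mass_ge:
  assumes "k \<le> D" "residual_ge k a s" "s \<in> \<int>" "s < real (geom p (Suc l))"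
  shows "s \<le> geom_ratio p l * real (card (N k a))"
  using assms
proof (induction l arbitrary: k a s)
  case (0 k a s)
  \<comment> \<open>As \<open>geom p 1 = 1\<close>, the integer \<open>s\<close> is at most
    0.\<close>
  then show ?case by (auto elim!: Ints_cases)
next
  case (Suc l k a s)
  show ?case
  proof (cases "k < D")
    case True
    have "s \<le> (1 + geom_ratio p l) * M k (a + int c * int p ^ k)" for c
    proof -
      let ?b = "a + int c * int p ^ k"
      have b: "residual_ge k ?b s" using Suc by (intro residual_ge_child)
      have "s - M k ?b \<le> geom_ratio p l * real (card (N (Suc k) ?b))"
        using Suc.prems True b
        by (intro Suc.IH residual_ge_Suc level_drop) (auto intro!: Ints_diff M_Ints)
      also have "\<dots> \<le> geom_ratio p l * M k ?b"
        by (intro mult_left_mono card_N_le_M) simp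
      finally show ?thesis by (simp add: algebra_simps)
    qed
    then have "(\<Sum>c<p. s) \<le> (\<Sum>c<p. (1 + geom_ratio p l) * M k (a + int c * int p ^ k))"
      by (intro sum_mono) auto
    also have "\<dots> \<le> (1 + geom_ratio p l) * real (card (N k a))"
      unfolding sum_distrib_left[symmetric]
      using sum_M_le Suc.prems(1) by (intro mult_left_mono) auto
    also have "\<dots> = real p * (geom_ratio p (Suc l) * real (card (N k a)))"
      using geom_ratio_Suc[OF p_pos] by (simp add: mult.assoc[symmetric])
    finally show ?thesis using p_pos by simp
  next
    case False
    then have "s \<le> 0" using Suc.prems(1) residual_ge_self[OF Suc.prems(2)] by auto
    then show ?thesis by (meson geom_ratio_nonneg mult_nonneg_nonneg of_nat_0_le_iff order_trans)
  qed
qed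

text \<open>Supplies the hypotheses \<open>s1 - m1 \<le> \<kappa> * m1\<close> and
  \<open>s2 - m2 \<le> \<kappa> * m2\<close> of \<open>edge_ineq\<close>, with
  \<open>geom_ratio p l\<close> as \<open>\<kappa>\<close>.\<close>

lemma residual_le_M:
  assumes "k < D" "residual_ge k a s" "s \<in> \<int>" "s < real (geom p (Suc (Suc l)))"
  shows "s - M k a \<le> geom_ratio p l * M k a"
proof -
  have "s - M k a \<le> geom_ratio p l * real (card (N (Suc k) a))"
    using assms
    by (intro mass_ge residual_ge_Suc level_drop) (auto intro!: Ints_diff M_Ints)
  also have "\<dots> \<le> geom_ratio p l * M k a"
    by (intro mult_left_mono card_N_le_M) simp
  finally show ?thesis .
qed

end


section \<open>Elementary inequalities for sums of minima and for a single edge\<close>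

lemma finite_max_exists:
  fixes f :: "'c \<Rightarrow> real"
  assumes "finite A" "A \<noteq> {}"
  obtains i where "i \<in> A" "\<And>i'. i' \<in> A \<Longrightarrow> f i' \<le> f i"
proof -
  have "Max (f ` A) \<in> f ` A" using assms by (intro Max_in) auto
  then obtain i where "i \<in> A" "f i = Max (f ` A)" by force
  with that[of i] assms show ?thesis by simp
qed

lemma sum_le_sum_sum_min:
  fixes f :: "'c \<Rightarrow> real" and g :: "'d \<Rightarrow> real"
  assumes "finite A" "\<And>i. i \<in> A \<Longrightarrow> 0 \<le> f i" "\<And>j. j \<in> B \<Longrightarrow> 0 \<le> g j"
    and "i \<in> A" "\<And>j. j \<in> B \<Longrightarrow> g j \<le> f i"
  shows "sum g B \<le> (\<Sum>i\<in>A. \<Sum>j\<in>B. min (f i) (g j))"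
proof -
  have "sum g B = (\<Sum>j\<in>B. min (f i) (g j))" using assms(5) by (intro sum.cong) auto
  also have "\<dots> \<le> (\<Sum>i\<in>A. \<Sum>j\<in>B. min (f i) (g j))"
    by (rule member_le_sum) (use assms in \<open>auto intro!: sum_nonneg\<close>)
  finally show ?thesis .
qed

text \<open>The largest of all values dominates the other family, so its row or column alone already
  sums to \<open>sum g B\<close> or \<open>sum f A\<close>.\<close>

lemma sum_sum_min_ge:
  fixes f :: "'c \<Rightarrow> real" and g :: "'d \<Rightarrow> real"
  assumes "finite A" "finite B" "\<And>i. i \<in> A \<Longrightarrow> 0 \<le> f i" "\<And>j. j \<in> B \<Longrightarrow> 0 \<le> g j"
  shows "min (sum f A) (sum g B) \<le> (\<Sum>i\<in>A. \<Sum>j\<in>B. min (f i) (g j))"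
proof (cases "A = {} \<or> B = {}")
  case True
  then show ?thesis by auto
next
  case False
  obtain i where i: "i \<in> A" "\<And>i'. i' \<in> A \<Longrightarrow> f i' \<le> f i"
    using finite_max_exists[of A f] assms False by blast
  obtain j where j: "j \<in> B" "\<And>j'. j' \<in> B \<Longrightarrow> g j' \<le> g j"
    using finite_max_exists[of B g] assms False by blast
  show ?thesis
  proof (cases "g j \<le> f i")
    case True
    have "sum g B \<le> (\<Sum>i\<in>A. \<Sum>j\<in>B. min (f i) (g j))"
      by (rule sum_le_sum_sum_min[OF _ _ _ i(1)])
        (use assms order_trans[OF j(2) True] in auto)
    then show ?thesis by simp
  next
    case False
    then have "f i \<le> g j" by simp
    have "sum f A \<le> (\<Sum>j\<in>B. \<Sum>i\<in>A. min (g j) (f i))"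
      by (rule sum_le_sum_sum_min[OF _ _ _ j(1)])
        (use assms order_trans[OF i(2) \<open>f i \<le> g j\<close>] in auto)
    also have "\<dots> = (\<Sum>i\<in>A. \<Sum>j\<in>B. min (f i) (g j))"
      by (subst sum.swap) (simp add: min.commute)
    finally show ?thesis by simp
  qed
qed

text \<open>For \<open>\<kappa> > 0\<close>, right side minus left side is
  \<open>(\<kappa> * m1 - (s1 - m1)) * (\<kappa> * m2 - (s2 - m2))\<close> divided by
  \<open>\<kappa> * (1 + \<kappa>)\<close>, with both factors nonnegative.\<close>

lemma edge_ineq_inner:
  fixes m1 m2 s1 s2 \<kappa> :: real
  assumes "0 \<le> \<kappa>" "m1 \<le> s1" "m2 \<le> s2" "s1 - m1 \<le> \<kappa> * m1" "s2 - m2 \<le> \<kappa> * m2"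
  shows "s1 * s2 / (1 + \<kappa>) \<le> m1 * m2 + (s1 - m1) * (s2 - m2) / \<kappa>"
proof (cases "\<kappa> = 0")
  case True
  \<comment> \<open>The quotient by \<open>\<kappa> = 0\<close> is 0 by convention, and its
    numerator vanishes too.\<close>
  then have "s1 = m1" "s2 = m2" using assms by auto
  then show ?thesis using True by simp
next
  case False
  then have k: "0 < \<kappa>" using assms(1) by simp
  let ?X = "m1 * m2 + (s1 - m1) * (s2 - m2) / \<kappa>"
  have X: "\<kappa> * ?X = \<kappa> * (m1 * m2) + (s1 - m1) * (s2 - m2)"
    using k by (simp only: distrib_left) simp
  have "0 \<le> (\<kappa> * m1 - (s1 - m1)) * (\<kappa> * m2 - (s2 - m2))"
    using assms(4,5) by (intro mult_nonneg_nonneg) simp_all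
  also have "\<dots> = \<kappa> * ?X * (1 + \<kappa>) - \<kappa> * (s1 * s2)"
    unfolding X by (simp add: ring_distribs)
  finally have "\<kappa> * (s1 * s2) \<le> \<kappa> * (?X * (1 + \<kappa>))" by (simp add: mult.assoc)
  then have "s1 * s2 \<le> ?X * (1 + \<kappa>)" by (simp only: mult_le_cancel_left_pos[OF k])
  then show ?thesis using k by (simp only: pos_divide_le_eq)
qed

text \<open>The inductive step of \<open>energy_ge\<close> along one edge: \<open>m1\<close>,
  \<open>m2\<close> are collected on it, \<open>s1\<close>, \<open>s2\<close> are guaranteed to
  remain above it, and \<open>R1\<close>, \<open>R2\<close> actually remain.\<close>

lemma edge_ineq:
  fixes m1 m2 s1 s2 \<kappa> R1 R2 e :: real
  assumes k: "0 \<le> \<kappa>" and s: "1 \<le> s1" "1 \<le> s2" and m: "1 \<le> m1" "1 \<le> m2"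
    and sm: "s1 - m1 \<le> \<kappa> * m1" "s2 - m2 \<le> \<kappa> * m2"
    and e: "min (R1 - m1 - max 0 (s1 - m1)) (R2 - m2 - max 0 (s2 - m2))
        + max 0 (s1 - m1) * max 0 (s2 - m2) / \<kappa> \<le> e"
  shows "min (R1 - s1) (R2 - s2) + s1 * s2 / (1 + \<kappa>) \<le> m1 * m2 + e"
proof -
  have div1: "s1 * s2 / (1 + \<kappa>) \<le> s1 * m2" "s1 * s2 / (1 + \<kappa>) \<le> m1 * s2"
    "s1 * s2 / (1 + \<kappa>) \<le> s1 * s2"
  proof -
    have k1: "0 < 1 + \<kappa>" using k by simp
    have "s1 \<le> m1 * (1 + \<kappa>)" "s2 \<le> m2 * (1 + \<kappa>)"
      using sm by (simp_all add: distrib_left mult.commute)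
    then have a: "s1 / (1 + \<kappa>) \<le> m1" "s2 / (1 + \<kappa>) \<le> m2"
      by (simp_all only: pos_divide_le_eq[OF k1])
    have "0 \<le> s2 * \<kappa>" using k s by simp
    then have "s2 \<le> s2 * (1 + \<kappa>)" by (simp add: distrib_left)
    then have b: "s2 / (1 + \<kappa>) \<le> s2" by (simp only: pos_divide_le_eq[OF k1])
    show "s1 * s2 / (1 + \<kappa>) \<le> s1 * m2" "s1 * s2 / (1 + \<kappa>) \<le> s1 * s2"
      using mult_left_mono[OF a(2), of s1] mult_left_mono[OF b, of s1] s by simp_all
    show "s1 * s2 / (1 + \<kappa>) \<le> m1 * s2"
      using mult_right_mono[OF a(1), of s2] s by simp
  qed
  \<comment> \<open>A surplus \<open>m1 - s1\<close> or \<open>m2 - s2\<close> is lost from the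
    slack below the edge; the product \<open>m1 * m2\<close> makes up for it, because all of
    \<open>m1\<close>, \<open>m2\<close>, \<open>s2\<close> are at least 1.\<close>
  consider "m1 \<le> s1" "m2 \<le> s2" | "s1 < m1" "m2 \<le> s2" | "m1 \<le> s1" "s2 < m2" | "s1 < m1" "s2 < m2"
    by linarith
  then show ?thesis
  proof cases
    case 1
    then show ?thesis using edge_ineq_inner[OF k 1 sm] e by (simp add: max_def)
  next
    case 2
    have "(m1 - s1) * 1 \<le> (m1 - s1) * m2" using 2 m by (intro mult_left_mono) auto
    then have "s1 * m2 + (m1 - s1) \<le> m1 * m2" by (simp add: algebra_simps)
    then show ?thesis using 2 e div1 by (simp add: max_def min_def split: if_splits)
  next
    case 3
    have "(m2 - s2) * 1 \<le> (m2 - s2) * m1" using 3 m by (intro mult_left_mono) auto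
    then have "m1 * s2 + (m2 - s2) \<le> m1 * m2" by (simp add: algebra_simps)
    then show ?thesis using 3 e div1 by (simp add: max_def min_def split: if_splits)
  next
    case 4
    have "(m2 - s2) * 1 \<le> (m2 - s2) * m1" "(m1 - s1) * 1 \<le> (m1 - s1) * s2"
      using 4 m s by (auto intro!: mult_left_mono)
    then have "s1 * s2 + (m1 - s1) + (m2 - s2) \<le> m1 * m2" by (simp add: algebra_simps)
    then show ?thesis using 4 e div1 by (simp add: max_def min_def split: if_splits)
  qed
qed

section \<open>The mutual energy of two families of roots\<close>

locale potential_tree_pair = X: potential_tree p D I x + Y: potential_tree p D J y
  for p D :: nat and I :: "'i set" and x :: "'i \<Rightarrow> int \<Rightarrow> real"
    and J :: "'j set" and y :: "'j \<Rightarrow> int \<Rightarrow> real" +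
  fixes z :: "'i \<Rightarrow> 'j \<Rightarrow> real"
  assumes min_le_z: "i \<in> I \<Longrightarrow> j \<in> J \<Longrightarrow> min (x i n) (y j n) \<le> z i j"
begin

definition pair_energy :: "nat \<Rightarrow> int \<Rightarrow> 'i \<Rightarrow> 'j \<Rightarrow> real" where
  "pair_energy k a i j = (if real k \<le> x i a \<and> real k \<le> y j a then z i j - real k else 0)"

definition energy :: "nat \<Rightarrow> int \<Rightarrow> real" where
  "energy k a = (\<Sum>i\<in>I. \<Sum>j\<in>J. pair_energy k a i j)"

lemma pair_energy_nonneg: "i \<in> I \<Longrightarrow> j \<in> J \<Longrightarrow> 0 \<le> pair_energy k a i j"
  using min_le_z[of i j a] by (auto simp: pair_energy_def)

text \<open>Both families are compared at the single integer \<open>a\<close>: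
  \<open>min_le_z\<close> bounds each pair, and \<open>sum_sum_min_ge\<close> the double
  sum.\<close>

lemma energy_base:
  assumes "k \<le> D"
  shows "min (X.Phi D a - X.Phi k a) (Y.Phi D a - Y.Phi k a) \<le> energy k a"
proof -
  let ?f = "\<lambda>i. min (x i a) (real D) - min (x i a) (real k)"
  let ?g = "\<lambda>j. min (y j a) (real D) - min (y j a) (real k)"
  have "min (X.Phi D a - X.Phi k a) (Y.Phi D a - Y.Phi k a) = min (sum ?f I) (sum ?g J)"
    by (simp add: X.Phi_def Y.Phi_def sum_subtractf)
  also have "\<dots> \<le> (\<Sum>i\<in>I. \<Sum>j\<in>J. min (?f i) (?g j))"
    using assms by (intro sum_sum_min_ge X.fin Y.fin) auto
  also have "\<dots> \<le> energy k a"
    unfolding energy_def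
  proof (intro sum_mono)
    fix i j assume ij: "i \<in> I" "j \<in> J"
    show "min (?f i) (?g j) \<le> pair_energy k a i j"
      using min_le_z[OF ij, of a] assms by (auto simp: pair_energy_def)
  qed
  finally show ?thesis .
qed

text \<open>A pair contributes at no more than one child. There the product of two shares from
  \<open>[0, 1]\<close> is at most their minimum, which is covered by the stretch from depth
  \<open>k\<close> to \<open>k + 1\<close>.\<close>

lemma energy_step:
  assumes "k < D"
  shows "(\<Sum>c<p. X.M k (a + int c * int p ^ k) * Y.M k (a + int c * int p ^ k)
      + energy (Suc k) (a + int c * int p ^ k)) \<le> energy k a"
proof -
  let ?b = "\<lambda>c. a + int c * int p ^ k"
  let ?t = "\<lambda>i j c. X.mu k i (?b c) * Y.mu k j (?b c) + pair_energy (Suc k) (?b c) i j"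
  have "(\<Sum>c<p. X.M k (?b c) * Y.M k (?b c) + energy (Suc k) (?b c)) = (\<Sum>c<p. \<Sum>i\<in>I. \<Sum>j\<in>J. ?t i j c)"
    unfolding X.M_eq Y.M_eq energy_def by (simp add: sum_product sum.distrib)
  also have "\<dots> = (\<Sum>i\<in>I. \<Sum>j\<in>J. \<Sum>c<p. ?t i j c)"
    by (subst sum.swap) (intro sum.cong refl sum.swap)
  also have "\<dots> \<le> energy k a"
    unfolding energy_def
  proof (intro sum_mono)
    fix i j assume ij: "i \<in> I" "j \<in> J"
    have t0: "?t i j c = 0" if "x i (?b c) \<le> real k \<or> y j (?b c) \<le> real k" for c
      using that X.mu_eq_0[of i "?b c" k] Y.mu_eq_0[of j "?b c" k] by (auto simp: pair_energy_def)
    show "(\<Sum>c<p. ?t i j c) \<le> pair_energy k a i j"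
    proof (rule sum_le_single_support)
      fix c d assume "c \<in> {..<p}" "d \<in> {..<p}" "?t i j c \<noteq> 0" "?t i j d \<noteq> 0"
      then show "c = d"
        using X.child_unique[OF ij(1), of c d k a] t0[of c] t0[of d] by force
    next
      fix c
      show "?t i j c \<le> pair_energy k a i j"
      proof (cases "x i (?b c) \<le> real k \<or> y j (?b c) \<le> real k")
        case True
        then show ?thesis using t0[OF True] pair_energy_nonneg[OF ij, of k a] by simp
      next
        case False
        then have k: "real k \<le> x i (?b c)" "real k \<le> y j (?b c)" by auto
        then have "pair_energy k a i j = z i j - real k"
          using X.x_child[OF ij(1), of k a c] Y.x_child[OF ij(2), of k a c] assms by (simp add: pair_energy_def)
        moreover have "X.mu k i (?b c) * Y.mu k j (?b c) \<le> min (X.mu k i (?b c)) (Y.mu k j (?b c))"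
          using X.mu_nonneg[of k i "?b c"] X.mu_le_1[of k i "?b c"]
            Y.mu_nonneg[of k j "?b c"] Y.mu_le_1[of k j "?b c"]
          by (auto simp: mult_left_le mult_left_le_one_le)
        moreover have "X.mu k i (?b c) = min (x i (?b c) - real k) 1"
          "Y.mu k j (?b c) = min (y j (?b c) - real k) 1"
          using k X.mu_eq Y.mu_eq by auto
        ultimately show ?thesis
          using min_le_z[OF ij, of "?b c"] by (auto simp: pair_energy_def)
      qed
    qed (use ij pair_energy_nonneg in auto)
  qed
  finally show ?thesis .
qed

text \<open>
  Since \<open>geom_ratio p 0 = 0\<close> and \<open>x / 0 = 0\<close>, the case \<open>l = 0\<close> only claims the first summand; there
  \<open>s1 = s2 = 0\<close>.
\<close>

theorem energy_ge:
  assumes "k \<le> D" "X.residual_ge k a s1" "Y.residual_ge k a s2" "s1 \<in> \<int>" "s2 \<in> \<int>" "0 \<le> s1" "0 \<le> s2"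
    "s1 < real (geom p (Suc l))" "s2 < real (geom p (Suc l))"
  shows "min (X.Phi D a - X.Phi k a - s1) (Y.Phi D a - Y.Phi k a - s2) + s1 * s2 / geom_ratio p l \<le> energy k a"
  using assms
proof (induction l arbitrary: k a s1 s2)
  case (0 k a s1 s2)
  then have "s1 = 0" "s2 = 0" by (auto elim!: Ints_cases)
  then show ?case using energy_base[OF 0(1), of a] by simp
next
  case (Suc l k a s1 s2)
  show ?case
  proof (cases "s1 = 0 \<or> s2 = 0")
    case True
    then show ?thesis using energy_base[OF Suc.prems(1), of a] Suc.prems(6,7) by auto
  next
    case False
    then have s: "1 \<le> s1" "1 \<le> s2" using Suc.prems(4-7) by (auto elim!: Ints_cases)
    have kD: "k < D"
    proof (rule ccontr)
      assume "\<not> k < D"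
      then show False using s Suc.prems(1) X.residual_ge_self[OF Suc.prems(2)] by auto
    qed
    let ?b = "\<lambda>c. a + int c * int p ^ k"
    let ?R1 = "\<lambda>n. X.Phi D n - X.Phi k n" and ?R2 = "\<lambda>n. Y.Phi D n - Y.Phi k n"
    let ?m = "\<lambda>c. min (?R1 (?b c) - s1) (?R2 (?b c) - s2)"
    have edge: "?m c + s1 * s2 / (1 + geom_ratio p l)
        \<le> X.M k (?b c) * Y.M k (?b c) + energy (Suc k) (?b c)" for c
    proof (rule edge_ineq)
      let ?s1 = "s1 - X.M k (?b c)" and ?s2 = "s2 - Y.M k (?b c)"
      have r: "X.residual_ge k (?b c) s1" "Y.residual_ge k (?b c) s2"
        using Suc.prems X.residual_ge_child Y.residual_ge_child by auto
      show sM: "?s1 \<le> geom_ratio p l * X.M k (?b c)" "?s2 \<le> geom_ratio p l * Y.M k (?b c)"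
        using X.residual_le_M[OF kD r(1)] Y.residual_le_M[OF kD r(2)] Suc.prems by auto
      show "1 \<le> X.M k (?b c)" "1 \<le> Y.M k (?b c)"
      proof -
        \<comment> \<open>With nothing collected, \<open>sM\<close> would force the positive
          guarantee to be at most 0; integrality then improves nonzero to at least 1.\<close>
        have "X.M k (?b c) \<noteq> 0" "Y.M k (?b c) \<noteq> 0" using sM s by auto
        then show "1 \<le> X.M k (?b c)" "1 \<le> Y.M k (?b c)"
          using X.M_Ints[OF kD, of "?b c"] X.M_nonneg[of k "?b c"]
            Y.M_Ints[OF kD, of "?b c"] Y.M_nonneg[of k "?b c"]
          by (auto elim!: Ints_cases)
      qed
      \<comment> \<open>The edge may collect more than was guaranteed, so the guarantee below it is
        cut off at 0.\<close>
      have "min (X.Phi D (?b c) - X.Phi (Suc k) (?b c) - max 0 ?s1)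
          (Y.Phi D (?b c) - Y.Phi (Suc k) (?b c) - max 0 ?s2) + max 0 ?s1 * max 0 ?s2 / geom_ratio p l
          \<le> energy (Suc k) (?b c)"
      proof (rule Suc.IH)
        show "X.residual_ge (Suc k) (?b c) (max 0 ?s1)" "Y.residual_ge (Suc k) (?b c) (max 0 ?s2)"
          using X.residual_ge_Suc[OF kD r(1)] Y.residual_ge_Suc[OF kD r(2)] X.residual_ge_0[of "Suc k" "?b c"]
            Y.residual_ge_0[of "Suc k" "?b c"] kD by (auto simp: max_def)
        have "0 < real (geom p (Suc l))" using X.p_pos by (simp add: add_nonneg_pos)
        then show "max 0 ?s1 < real (geom p (Suc l))" "max 0 ?s2 < real (geom p (Suc l))"
          using X.level_drop[OF kD r(1)] Y.level_drop[OF kD r(2)] Suc.prems by auto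
        show "max 0 ?s1 \<in> \<int>" "max 0 ?s2 \<in> \<int>"
          using Suc.prems X.M_Ints[OF kD, of "?b c"] Y.M_Ints[OF kD, of "?b c"]
          by (auto simp: max_def)
      qed (use kD in auto)
      then show "min (?R1 (?b c) - X.M k (?b c) - max 0 ?s1) (?R2 (?b c) - Y.M k (?b c) - max 0 ?s2)
          + max 0 ?s1 * max 0 ?s2 / geom_ratio p l \<le> energy (Suc k) (?b c)"
        by (simp add: X.M_def Y.M_def algebra_simps)
    qed (use s in auto)
    have m_nonneg: "0 \<le> ?m c" for c
      using X.residual_ge_self[OF X.residual_ge_child[OF Suc.prems(2)], of c]
        Y.residual_ge_self[OF Y.residual_ge_child[OF Suc.prems(3)], of c] by simp
    \<comment> \<open>Only the slack at \<open>c = 0\<close>, the child of \<open>a\<close> itself,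
      is kept, whereas \<open>s1 * s2 / (1 + geom_ratio p l)\<close> is gained at all
      \<open>p\<close> children.\<close>
    have "?m 0 \<le> (\<Sum>c<p. ?m c)"
      by (rule member_le_sum[of 0 "{..<p}" ?m]) (use X.p_pos m_nonneg in auto)
    moreover have "s1 * s2 / geom_ratio p (Suc l) = real p * (s1 * s2 / (1 + geom_ratio p l))"
      using geom_ratio_Suc[OF X.p_pos, of l, symmetric] X.p_pos by simp
    ultimately have "?m 0 + s1 * s2 / geom_ratio p (Suc l) \<le> (\<Sum>c<p. ?m c + s1 * s2 / (1 + geom_ratio p l))"
      by (simp add: sum.distrib)
    also have "\<dots> \<le> (\<Sum>c<p. X.M k (?b c) * Y.M k (?b c) + energy (Suc k) (?b c))"
      by (intro sum_mono edge)
    also have "\<dots> \<le> energy k a" by (rule energy_step[OF kD])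
    finally show ?thesis by simp
  qed
qed

end

section \<open>The resultant as a product over the roots\<close>

definition root_poly :: "nat \<Rightarrow> (nat \<Rightarrow> 'a::comm_ring_1) \<Rightarrow> 'a poly" where
  "root_poly n \<alpha> = (\<Prod>i<n. [:- \<alpha> i, 1:])"

lemma poly_root_poly: "poly (root_poly n \<alpha>) x = (\<Prod>i<n. x - \<alpha> i)"
  by (simp add: root_poly_def poly_prod)

lemma degree_root_poly [simp]: "degree (root_poly n (\<alpha> :: nat \<Rightarrow> 'a::idom)) = n"
  unfolding root_poly_def by (subst degree_prod_eq_sum_degree) auto

lemma monic_root_poly [simp]: "coeff (root_poly n (\<alpha> :: nat \<Rightarrow> 'a::idom)) n = 1"
  using monic_prod[of "{..<n}" "\<lambda>i. [:- \<alpha> i, 1:]"] degree_root_poly[of n \<alpha>]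
  by (simp add: root_poly_def)

lemma alg_closed_root_poly:
  fixes q :: "'a::alg_closed_field poly"
  assumes "q \<noteq> 0"
  obtains \<alpha> where "q = smult (lead_coeff q) (root_poly (degree q) \<alpha>)"
proof -
  obtain A where A: "size A = degree q" "q = smult (lead_coeff q) (\<Prod>x\<in>#A. [:-x, 1:])"
    using alg_closed_imp_factorization[OF assms] by blast
  obtain xs where xs: "mset xs = A" using ex_mset by blast
  have "(\<Prod>x\<in>#A. [:-x, 1:]) = (\<Prod>x\<leftarrow>xs. [:-x, 1:])"
    unfolding xs[symmetric] by (metis mset_map prod_mset_prod_list)
  also have "\<dots> = root_poly (degree q) (\<lambda>i. xs ! i)"
    using A xs unfolding root_poly_def by (subst prod.list_conv_set_nth) (auto simp: atLeast0LessThan)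
  finally show ?thesis using A(2) that by metis
qed

lemma prod_diff_swap_sq:
  fixes \<alpha> \<beta> :: "nat \<Rightarrow> 'a::comm_ring_1"
  shows "(\<Prod>j<n. \<Prod>i<m. \<beta> j - \<alpha> i)\<^sup>2 = (\<Prod>i<m. \<Prod>j<n. \<alpha> i - \<beta> j)\<^sup>2"
proof -
  have "(\<Prod>j<n. \<Prod>i<m. \<beta> j - \<alpha> i)\<^sup>2 = (\<Prod>j<n. \<Prod>i<m. (\<beta> j - \<alpha> i)\<^sup>2)"
    by (simp add: prod_power_distrib)
  also have "\<dots> = (\<Prod>i<m. \<Prod>j<n. (\<alpha> i - \<beta> j)\<^sup>2)"
    by (subst prod.swap) (simp add: power2_commute)
  finally show ?thesis by (simp add: prod_power_distrib)
qed

text \<open>Squares absorb the signs produced by swapping the arguments and by the Euclidean steps.\<close>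

lemma resultant_root_poly_sq:
  fixes \<alpha> \<beta> :: "nat \<Rightarrow> 'a::alg_closed_field"
  shows "(resultant (root_poly m \<alpha>) (root_poly n \<beta>))\<^sup>2 = (\<Prod>i<m. \<Prod>j<n. \<alpha> i - \<beta> j)\<^sup>2"
proof (induction "m + n" arbitrary: m n \<alpha> \<beta> rule: less_induct)
  case less
  \<comment> \<open>One Euclidean step, larger degree first: the pair \<open>?F\<close>,
    \<open>?G\<close> is replaced by \<open>?G\<close> and the remainder \<open>H\<close>.\<close>
  have main: "(resultant (root_poly m \<alpha>) (root_poly n \<beta>))\<^sup>2 = (\<Prod>i<m. \<Prod>j<n. \<alpha> i - \<beta> j)\<^sup>2"
    if le: "n \<le> m" and IH: "\<And>k \<gamma>. k < n \<Longrightarrow>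
      (resultant (root_poly n \<beta>) (root_poly k \<gamma>))\<^sup>2 = (\<Prod>i<n. \<Prod>j<k. \<beta> i - \<gamma> j)\<^sup>2"
    for m n :: nat and \<alpha> \<beta> :: "nat \<Rightarrow> 'a"
  proof (cases "n = 0")
    case True
    then show ?thesis by (simp add: root_poly_def)
  next
    case False
    let ?F = "root_poly m \<alpha>" and ?G = "root_poly n \<beta>"
    define H where "H = ?F mod ?G"
    have G0: "?G \<noteq> 0" using False degree_root_poly[of n \<beta>] by force
    have FGH: "?F + (- (?F div ?G)) * ?G = H"
      by (simp add: H_def minus_mult_div_eq_mod[symmetric] mult.commute)
    have dH: "degree H < degree ?G"
      using degree_mod_less'[of ?G ?F] False G0 by (cases "H = 0") (auto simp: H_def)
    have dFG: "degree ?G \<le> degree ?F" using le by simp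
    \<comment> \<open>At the roots of \<open>?G\<close> the remainder takes the values of
      \<open>?F\<close>, so the product depends only on these values of \<open>H\<close>.\<close>
    have "poly ?F (\<beta> j) = poly H (\<beta> j)" if "j < n" for j
      using that by (subst FGH[symmetric]) (auto simp: poly_root_poly[of n])
    then have FH: "(\<Prod>i<m. \<Prod>j<n. \<alpha> i - \<beta> j)\<^sup>2 = (\<Prod>j<n. poly H (\<beta> j))\<^sup>2"
      by (subst prod_diff_swap_sq[symmetric]) (simp add: poly_root_poly)
    show ?thesis
    proof (cases "degree H = 0")
      case True
      then obtain c where c: "H = [:c:]" by (elim degree_eq_zeroE)
      have "subresultant 0 ?F ?G = smult ((-1) ^ (m * n) * c ^ (n - 1)) [:c:]"
        using BT_lemma_1_13[OF FGH dFG] dH c by simp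
      then have "resultant ?F ?G = (-1) ^ (m * n) * (c ^ (n - 1) * c)"
        by (simp add: subresultant_resultant mult.assoc)
      also have "c ^ (n - 1) * c = c ^ n" using False by (simp flip: power_Suc2)
      finally show ?thesis unfolding FH by (simp add: c power_mult_distrib flip: power_mult)
    next
      case dH0: False
      then have "H \<noteq> 0" by auto
      then obtain \<gamma> where \<gamma>: "H = smult (lead_coeff H) (root_poly (degree H) \<gamma>)"
        by (rule alg_closed_root_poly)
      let ?c = "lead_coeff H" and ?k = "degree H"
      have "subresultant 0 ?F ?G = smult ((-1) ^ (m * n)) (subresultant 0 ?G H)"
        using BT_lemma_1_12[OF FGH dFG, of 0] dH dH0 by simp
      then have "(resultant ?F ?G)\<^sup>2 = (resultant ?G H)\<^sup>2"
        by (simp add: subresultant_resultant power_mult_distrib flip: power_mult)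
      also have "resultant ?G H = ?c ^ n * resultant ?G (root_poly ?k \<gamma>)"
        by (subst \<gamma>) (use \<open>H \<noteq> 0\<close> in \<open>simp add: resultant_smult_right\<close>)
      also have "\<dots>\<^sup>2 = (?c ^ n * (\<Prod>i<n. \<Prod>j<?k. \<beta> i - \<gamma> j))\<^sup>2"
        using IH[of ?k \<gamma>] dH by (simp add: power_mult_distrib)
      also have "?c ^ n * (\<Prod>i<n. \<Prod>j<?k. \<beta> i - \<gamma> j) = (\<Prod>j<n. poly H (\<beta> j))"
        by (subst (3) \<gamma>) (simp add: poly_root_poly prod.distrib)
      finally show ?thesis unfolding FH .
    qed
  qed
  show ?case
  proof (cases "n \<le> m")
    case True
    show ?thesis by (rule main[OF True], rule less) (use True in auto)
  next
    case False
    have "(resultant (root_poly m \<alpha>) (root_poly n \<beta>))\<^sup>2 = (resultant (root_poly n \<beta>) (root_poly m \<alpha>))\<^sup>2"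
      by (subst resultant_swap) (simp add: power_mult_distrib flip: power_mult)
    also have "\<dots> = (\<Prod>i<n. \<Prod>j<m. \<beta> i - \<alpha> j)\<^sup>2"
      by (rule main, use False in simp, rule less) (use False in auto)
    finally show ?thesis by (simp add: prod_diff_swap_sq)
  qed
qed

lemma alg_closure_rat_algebraic: "algebraic (x :: rat alg_closure)"
proof -
  obtain q :: "rat poly" where q: "q \<noteq> 0" "poly (map_poly to_ac q) x = 0"
    using alg_closure_algebraic .
  have "to_ac r \<in> \<rat>" for r :: rat
  proof (cases r)
    case (Fract a b)
    then have "to_ac r = of_int a / of_int b" by (simp add: Fract_of_int_quotient)
    then show ?thesis by simp
  qed
  then show ?thesis using q
    by (intro algebraicI'[of "map_poly to_ac q"]) (auto simp: coeff_map_poly poly_eq_iff)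
qed

section \<open>Gauss's lemma and the potentials of an integer polynomial\<close>

context padic_val
begin

lemma p_pos: "p > 0" and p_gt_1: "p > 1"
  using prime prime_gt_1_nat prime_gt_0_nat by auto

lemma v_1 [simp]: "v 1 = 0"
  using v_int[of 1] by simp

lemma v_minus [simp]: "v (- x) = v x"
proof (cases "x = 0")
  case False
  have "v (- 1) = 0" using v_int[of "- 1"] by simp
  then show ?thesis using v_mult[of "- 1" x] False by simp
qed simp

lemma v_power: "x \<noteq> 0 \<Longrightarrow> v (x ^ n) = real n * v x"
  by (induction n) (simp_all add: v_mult algebra_simps)

lemma v_prod: "(\<And>i. i \<in> A \<Longrightarrow> f i \<noteq> 0) \<Longrightarrow> v (prod f A) = (\<Sum>i\<in>A. v (f i))"
  by (induction A rule: infinite_finite_induct) (simp_all add: v_mult)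

text \<open>The upper estimate is the ultrametric inequality for
  \<open>x = (x + y) + (- y)\<close>.\<close>

lemma v_add_eq:
  assumes "x \<noteq> 0" "y = 0 \<or> v x < v y" shows "x + y \<noteq> 0 \<and> v (x + y) = v x"
proof (cases "y = 0")
  case False
  have nz: "x + y \<noteq> 0"
  proof
    assume "x + y = 0"
    then have "y = - x" by (simp add: eq_neg_iff_add_eq_0 add.commute)
    then show False using assms False by simp
  qed
  have "min (v x) (v y) \<le> v (x + y)" "min (v (x + y)) (v (- y)) \<le> v x"
    using v_add[of x y] v_add[of "x + y" "- y"] assms False nz by auto
  then show ?thesis using assms False nz by auto
qed (use assms in simp)

text \<open>At 0, where \<open>v\<close> is unspecified, this is the infinite value cut off at
  \<open>D\<close>.\<close>

definition trunc :: "nat \<Rightarrow> 'a \<Rightarrow> real" where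
  "trunc D x = (if x = 0 then real D else min (v x) (real D))"

lemma trunc_le: "trunc D x \<le> real D"
  by (simp add: trunc_def)

lemma trunc_minus [simp]: "trunc D (- x) = trunc D x"
  by (simp add: trunc_def)

lemma trunc_commute: "trunc D (x - y) = trunc D (y - x)"
  by (metis minus_diff_eq trunc_minus)

lemma trunc_add: "min (trunc D x) (trunc D y) \<le> trunc D (x + y)"
  using v_add[of x y] by (auto simp: trunc_def)

lemma trunc_trans: "min (trunc D (x - y)) (trunc D (y - z)) \<le> trunc D (x - z)"
  using trunc_add[of D "x - y" "y - z"] by simp

lemma min_trunc: "k \<le> D \<Longrightarrow> min (trunc D x) (real k) = trunc k x"
  by (auto simp: trunc_def)

lemma trunc_of_int_ge:
  assumes "int p ^ k dvd n" "k \<le> D" shows "real k \<le> trunc D (of_int n)"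
proof (cases "n = 0")
  case False
  then have "k \<le> multiplicity (int p) n" 
    using assms(1) p_gt_1 by (intro multiplicity_geI) auto
  then show ?thesis using False assms(2) by (simp add: trunc_def v_int)
qed (use assms in \<open>simp add: trunc_def\<close>)

lemma trunc_of_int_gt:
  assumes "real k < trunc D (of_int n)" shows "int p ^ Suc k dvd n"
proof (cases "n = 0")
  case False
  then have "Suc k \<le> multiplicity (int p) n" using assms by (simp add: trunc_def v_int)
  then show ?thesis by (rule multiplicity_dvd')
qed simp

section \<open>Gauss's lemma and the integrality of potentials\<close>

definition gauss_val :: "'a poly \<Rightarrow> real \<Rightarrow> bool" where
  "gauss_val F r \<longleftrightarrow> (\<forall>j. coeff F j = 0 \<or> r \<le> v (coeff F j)) \<and> (\<exists>j. coeff F j \<noteq> 0 \<and> v (coeff F j) = r)"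

lemma vge_mult: "x = 0 \<or> r \<le> v x \<Longrightarrow> y = 0 \<or> s \<le> v y \<Longrightarrow> x * y = 0 \<or> r + s \<le> v (x * y)"
  using v_mult[of x y] by (cases "x = 0"; cases "y = 0") simp_all

lemma vge_add: "x = 0 \<or> r \<le> v x \<Longrightarrow> y = 0 \<or> r \<le> v y \<Longrightarrow> x + y = 0 \<or> r \<le> v (x + y)"
  using v_add[of x y] by (cases "x = 0"; cases "y = 0"; cases "x + y = 0") simp_all

text \<open>The lower estimate is ultrametric. It is attained at a coefficient of the product where
  one of the two summands strictly dominates, so that nothing cancels.\<close>

lemma gauss_val_mult_linear:
  assumes F: "gauss_val F r" and u: "u \<noteq> 0"
  shows "gauss_val ([:b, u:] * F) ((if b = 0 then v u else min (v u) (v b)) + r)"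
proof -
  let ?h = "if b = 0 then v u else min (v u) (v b)"
  have c: "coeff ([:b, u:] * F) j = b * coeff F j + (case j of 0 \<Rightarrow> 0 | Suc i \<Rightarrow> u * coeff F i)" for j
    by (simp add: coeff_pCons split: nat.splits)
  have ge: "coeff F j = 0 \<or> r \<le> v (coeff F j)" for j using F by (simp add: gauss_val_def)
  have "coeff ([:b, u:] * F) j = 0 \<or> ?h + r \<le> v (coeff ([:b, u:] * F) j)" for j
    unfolding c
  proof (rule vge_add)
    show "b * coeff F j = 0 \<or> ?h + r \<le> v (b * coeff F j)"
      by (rule vge_mult[OF _ ge]) auto
    have "u * coeff F i = 0 \<or> ?h + r \<le> v (u * coeff F i)" for i
      by (rule vge_mult[OF _ ge]) auto
    then show "(case j of 0 \<Rightarrow> 0 | Suc i \<Rightarrow> u * coeff F i) = 0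
        \<or> ?h + r \<le> v (case j of 0 \<Rightarrow> 0 | Suc i \<Rightarrow> u * coeff F i)"
      by (cases j) auto
  qed
  moreover have "\<exists>j. coeff ([:b, u:] * F) j \<noteq> 0 \<and> v (coeff ([:b, u:] * F) j) = ?h + r"
  proof (cases "b = 0 \<or> v u \<le> v b")
    case True
    \<comment> \<open>The last coefficient of least value is shifted up by \<open>u\<close>, and the
      next coefficient of \<open>F\<close> has strictly larger value or is 0.\<close>
    define J where "J = {j. coeff F j \<noteq> 0 \<and> v (coeff F j) = r}"
    have "J \<subseteq> {..degree F}" by (auto simp: J_def intro: le_degree)
    then have "finite J" by (rule finite_subset) simp
    have "J \<noteq> {}" using F by (auto simp: J_def gauss_val_def)
    have j: "Max J \<in> J" by (rule Max_in) fact+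
    have j': "Suc (Max J) \<notin> J"
    proof
      assume "Suc (Max J) \<in> J"
      from Max_ge[OF \<open>finite J\<close> this] show False by simp
    qed
    let ?j = "Max J"
    have ne: "u * coeff F ?j \<noteq> 0" and vj: "v (u * coeff F ?j) = v u + r"
      using j u by (simp_all add: J_def v_mult)
    have "coeff F (Suc ?j) = 0 \<or> r < v (coeff F (Suc ?j))"
      using j' ge[of "Suc ?j"] by (auto simp: J_def)
    then have "b * coeff F (Suc ?j) = 0 \<or> v (u * coeff F ?j) < v (b * coeff F (Suc ?j))"
      using True vj by (cases "b = 0"; cases "coeff F (Suc ?j) = 0") (auto simp: v_mult)
    from v_add_eq[OF ne this]
    have "coeff ([:b, u:] * F) (Suc ?j) \<noteq> 0 \<and> v (coeff ([:b, u:] * F) (Suc ?j)) = ?h + r"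
      unfolding c using True vj by (auto simp: add.commute min_def)
    then show ?thesis by blast
  next
    case False
    \<comment> \<open>Now \<open>b\<close> has strictly smaller value than \<open>u\<close>, so any
      coefficient of least value serves.\<close>
    obtain j where j: "coeff F j \<noteq> 0" "v (coeff F j) = r" using F by (auto simp: gauss_val_def)
    have ne: "b * coeff F j \<noteq> 0" and vj: "v (b * coeff F j) = v b + r"
      using j False by (auto simp: v_mult)
    let ?y = "case j of 0 \<Rightarrow> 0 | Suc i \<Rightarrow> u * coeff F i"
    have "u * coeff F i = 0 \<or> v b + r < v (u * coeff F i)" for i
      using False u ge[of i] by (cases "coeff F i = 0") (auto simp: v_mult)
    then have "?y = 0 \<or> v (b * coeff F j) < v ?y"
      unfolding vj by (auto split: nat.splits)
    from v_add_eq[OF ne this]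
    have "coeff ([:b, u:] * F) j \<noteq> 0 \<and> v (coeff ([:b, u:] * F) j) = ?h + r"
      unfolding c using False vj by simp
    then show ?thesis by blast
  qed
  ultimately show ?thesis by (simp add: gauss_val_def)
qed

lemma gauss_val_prod:
  fixes m :: nat
  assumes "q \<noteq> 0" "v q = real k"
  shows "gauss_val (\<Prod>i<m. [:b i, q:]) (\<Sum>i<m. trunc k (b i))"
proof (induction m)
  case 0
  show ?case by (auto simp: gauss_val_def coeff_1 intro: exI[of _ 0])
next
  case (Suc m)
  have "(if b m = 0 then v q else min (v q) (v (b m))) = trunc k (b m)"
    using assms by (simp add: trunc_def min.commute)
  then have "gauss_val ([:b m, q:] * (\<Prod>i<m. [:b i, q:])) (trunc k (b m) + (\<Sum>i<m. trunc k (b i)))"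
    using gauss_val_mult_linear[OF Suc assms(1), of "b m"] by simp
  then show ?case by (simp only: prod.lessThan_Suc sum.lessThan_Suc mult.commute add.commute)
qed

text \<open>Substituting \<open>n + p ^ k * X\<close> for the variable \<open>X\<close> gives
  factors \<open>(n - \<alpha> i) + p ^ k * X\<close> of Gauss value
  \<open>trunc k (n - \<alpha> i)\<close>. By Gauss's lemma the sum of these is the value of a
  coefficient of an integer polynomial.\<close>

lemma sum_trunc_nat:
  assumes f: "map_poly of_int f = root_poly m \<alpha>"
  obtains j :: nat where "(\<Sum>i<m. trunc k (\<alpha> i - of_int n)) = real j"
proof -
  let ?h = "f \<circ>\<^sub>p [:n, int p ^ k:]"
  have lin: "map_poly of_int [:n, c:] = [:of_int n, of_int c :: 'a:]" for c
    by (auto simp: poly_eq_iff coeff_map_poly coeff_pCons split: nat.splits)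
  have "map_poly of_int ?h = root_poly m \<alpha> \<circ>\<^sub>p [:of_int n, of_int (int p ^ k):]"
    unfolding lin[symmetric] f[symmetric] by (rule of_int_hom.map_poly_pcompose)
  also have "\<dots> = (\<Prod>i<m. [:of_int n - \<alpha> i, of_int (int p ^ k):])"
    by (simp add: root_poly_def pcompose_prod pcompose_pCons)
  finally have h: "map_poly of_int ?h = (\<Prod>i<m. [:of_int n - \<alpha> i, of_int (int p ^ k):])" .
  have q: "of_int (int p ^ k) \<noteq> (0 :: 'a)" "v (of_int (int p ^ k)) = real k"
    using v_int[of "int p ^ k"] prime p_pos by (auto simp: prime_elem_multiplicity_power_distrib)
  have "gauss_val (map_poly of_int ?h) (\<Sum>i<m. trunc k (of_int n - \<alpha> i))"
    unfolding h by (rule gauss_val_prod[OF q])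
  then obtain j where "coeff ?h j \<noteq> 0" "v (of_int (coeff ?h j)) = (\<Sum>i<m. trunc k (of_int n - \<alpha> i))"
    by (auto simp: gauss_val_def coeff_map_poly)
  then have "(\<Sum>i<m. trunc k (\<alpha> i - of_int n)) = real (multiplicity (int p) (coeff ?h j))"
    by (simp add: v_int trunc_commute[of k "of_int n"])
  then show ?thesis by (rule that)
qed

text \<open>For \<open>k = 0\<close> in \<open>sum_trunc_nat\<close>, terms that are at most 0 sum
  to a natural number, so all vanish: the roots are integral.\<close>

lemma trunc_root_nonneg:
  assumes f: "map_poly of_int f = root_poly m \<alpha>" and i: "i < m"
  shows "0 \<le> trunc D (\<alpha> i - of_int n)"
proof -
  obtain j :: nat where j: "(\<Sum>i<m. trunc 0 (\<alpha> i - of_int n)) = real j"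
    using sum_trunc_nat[OF f] .
  have "trunc 0 (\<alpha> i - of_int n) = 0"
  proof (rule ccontr)
    assume "trunc 0 (\<alpha> i - of_int n) \<noteq> 0"
    then have "(\<Sum>i<m. trunc 0 (\<alpha> i - of_int n)) < (\<Sum>i<m. 0)"
      using i trunc_le[of 0] by (intro sum_strict_mono_ex1) (auto intro!: bexI[of _ i] simp: less_le)
    with j show False by simp
  qed
  then show ?thesis by (auto simp: trunc_def split: if_splits)
qed

text \<open>Congruence and separation are the ultrametric inequality for two integers and a root;
  integrality is \<open>sum_trunc_nat\<close>.\<close>

lemma potential_tree_roots:
  assumes f: "map_poly of_int f = root_poly m \<alpha>"
  shows "potential_tree p D {..<m} (\<lambda>i n. trunc D (\<alpha> i - of_int n))"
proof
  fix i k :: nat and n n' :: int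
  have half: "min (trunc D (\<alpha> i - of_int n')) (real k) \<le> trunc D (\<alpha> i - of_int n)"
    if "k \<le> D" "int p ^ k dvd n' - n" for k n n'
    using trunc_trans[of D "\<alpha> i" "of_int n'" "of_int n"] trunc_of_int_ge[OF that(2,1)] by simp
  show "min (trunc D (\<alpha> i - of_int n)) (real k) = min (trunc D (\<alpha> i - of_int n')) (real k)"
    if "k \<le> D" "int p ^ k dvd n - n'"
    using half[of k n' n] half[of k n n'] that by (simp add: dvd_diff_commute)
  show "int p ^ Suc k dvd n - n'"
    if "real k < trunc D (\<alpha> i - of_int n)" "real k < trunc D (\<alpha> i - of_int n')"
    using trunc_trans[of D "of_int n" "\<alpha> i" "of_int n'"] that trunc_commute[of D "\<alpha> i" "of_int n"]
    by (intro trunc_of_int_gt[of _ D]) auto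
  show "(\<Sum>i<m. min (trunc D (\<alpha> i - of_int n)) (real k)) \<in> \<int>" if "k \<le> D"
  proof -
    obtain j :: nat where "(\<Sum>i<m. trunc k (\<alpha> i - of_int n)) = real j" using sum_trunc_nat[OF f] .
    then show ?thesis using that by (simp add: min_trunc)
  qed
qed (use f p_pos trunc_root_nonneg in auto)

text \<open>One root agreeing with \<open>n\<close> to depth \<open>D\<close> suffices; otherwise
  the truncation changes nothing and the sum is the value of \<open>poly f n\<close>.\<close>

lemma sum_trunc_ge:
  assumes f: "map_poly of_int f = root_poly m \<alpha>" and "T \<le> D" "enat T \<le> vp p (poly f n)"
  shows "real T \<le> (\<Sum>i<m. trunc D (\<alpha> i - of_int n))"
proof (cases "\<exists>i<m. trunc D (\<alpha> i - of_int n) = real D")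
  case True
  then obtain i where i: "i < m" "trunc D (\<alpha> i - of_int n) = real D" by blast
  have "trunc D (\<alpha> i - of_int n) \<le> (\<Sum>i<m. trunc D (\<alpha> i - of_int n))"
    by (rule member_le_sum) (use i trunc_root_nonneg[OF f] in auto)
  then show ?thesis using i assms(2) by simp
next
  case False
  then have *: "\<alpha> i - of_int n \<noteq> 0" "trunc D (\<alpha> i - of_int n) = v (\<alpha> i - of_int n)" if "i < m" for i
    using that by (auto simp: trunc_def min_def split: if_splits)
  have "of_int (poly f n) = poly (root_poly m \<alpha>) (of_int n)"
    by (simp flip: f)
  also have "\<dots> = (\<Prod>i<m. of_int n - \<alpha> i)" by (rule poly_root_poly)
  finally have eq: "of_int (poly f n) = (\<Prod>i<m. of_int n - \<alpha> i)" .
  have nz: "of_int n - \<alpha> i \<noteq> 0" if "i < m" for i using *(1)[OF that] by auto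
  then have "poly f n \<noteq> 0" using eq by (auto dest: arg_cong[of _ _ "\<lambda>x. x = 0"])
  then have "real (multiplicity (int p) (poly f n)) = v (\<Prod>i<m. of_int n - \<alpha> i)"
    by (simp add: v_int flip: eq)
  also have "\<dots> = (\<Sum>i<m. v (of_int n - \<alpha> i))" by (rule v_prod) (use nz in auto)
  also have "\<dots> = (\<Sum>i<m. trunc D (\<alpha> i - of_int n))"
  proof (rule sum.cong)
    fix i assume "i \<in> {..<m}"
    then show "v (of_int n - \<alpha> i) = trunc D (\<alpha> i - of_int n)"
      using *(2)[of i] v_minus[of "\<alpha> i - of_int n"] by simp
  qed simp
  finally show ?thesis using assms(3) \<open>poly f n \<noteq> 0\<close> by (simp add: vp_def)
qed

lemma resultant_bound:
  fixes f g :: "int poly" and \<alpha> \<beta> :: "nat \<Rightarrow> 'a"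
  assumes f: "map_poly of_int f = root_poly m1 \<alpha>" and g: "map_poly of_int g = root_poly m2 \<beta>"
    and r0: "resultant f g \<noteq> 0"
    and r: "(of_int (resultant f g))\<^sup>2 = (\<Prod>i<m1. \<Prod>j<m2. \<alpha> i - \<beta> j)\<^sup>2"
    and s1: "\<And>n. enat s1 \<le> vp p (poly f n)" and s2: "\<And>n. enat s2 \<le> vp p (poly g n)"
    and T: "enat T \<le> vp p (poly f n)" "enat T \<le> vp p (poly g n)"
    and l: "max s1 s2 < geom p (Suc l)"
  shows "real T - real (max s1 s2) + real s1 * real s2 / geom_ratio p l
    \<le> real (multiplicity (int p) (resultant f g))"
proof -
  let ?P = "\<Prod>i<m1. \<Prod>j<m2. \<alpha> i - \<beta> j"
  have P: "?P \<noteq> 0"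
  proof
    assume "?P = 0"
    then have "(of_int (resultant f g))\<^sup>2 = (0 :: 'a)" unfolding r by simp
    then show False using r0 by simp
  qed
  then have nz: "\<alpha> i - \<beta> j \<noteq> 0" if "i < m1" "j < m2" for i j
    using that by auto
  \<comment> \<open>Deep enough for the truncated potentials to retain the lower bounds
    \<open>T\<close>, \<open>s1\<close> and \<open>s2\<close>.\<close>
  define D where "D = max T (max s1 s2)"
  interpret X: potential_tree p D "{..<m1}" "\<lambda>i n. trunc D (\<alpha> i - of_int n)" by (rule potential_tree_roots[OF f])
  interpret Y: potential_tree p D "{..<m2}" "\<lambda>i n. trunc D (\<beta> i - of_int n)" by (rule potential_tree_roots[OF g])
  interpret potential_tree_pair p D "{..<m1}" "\<lambda>i n. trunc D (\<alpha> i - of_int n)"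
    "{..<m2}" "\<lambda>i n. trunc D (\<beta> i - of_int n)" "\<lambda>i j. trunc D (\<alpha> i - \<beta> j)"
  proof
    fix i j :: nat and n :: int
    show "min (trunc D (\<alpha> i - of_int n)) (trunc D (\<beta> j - of_int n)) \<le> trunc D (\<alpha> i - \<beta> j)"
      using trunc_trans[of D "\<alpha> i" "of_int n" "\<beta> j"] by (simp add: trunc_commute[of D "\<beta> j"])
  qed
  have Phi0: "X.Phi 0 n = 0" "Y.Phi 0 n = 0" for n
    using X.nonneg Y.nonneg by (auto simp: X.Phi_def Y.Phi_def min_absorb2 intro!: sum.neutral)
  have PhiD: "X.Phi D n = (\<Sum>i<m1. trunc D (\<alpha> i - of_int n))" "Y.Phi D n = (\<Sum>i<m2. trunc D (\<beta> i - of_int n))" for n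
    unfolding X.Phi_def Y.Phi_def by (simp_all add: trunc_le min_absorb1)
  have "real s1 \<le> X.Phi D n" "real s2 \<le> Y.Phi D n" for n
    unfolding PhiD by (rule sum_trunc_ge[OF f _ s1] sum_trunc_ge[OF g _ s2]; simp add: D_def)+
  then have res: "X.residual_ge 0 n (real s1)" "Y.residual_ge 0 n (real s2)"
    by (simp_all add: X.residual_ge_def Y.residual_ge_def Phi0)
  have TD: "real T \<le> X.Phi D n" "real T \<le> Y.Phi D n"
    unfolding PhiD by (rule sum_trunc_ge[OF f _ T(1)] sum_trunc_ge[OF g _ T(2)]; simp add: D_def)+
  \<comment> \<open>Depth 0 has one class, all integers; its base point is the \<open>n\<close> at
    which both potentials reach \<open>T\<close>.\<close>
  have "min (X.Phi D n - X.Phi 0 n - real s1) (Y.Phi D n - Y.Phi 0 n - real s2)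
      + real s1 * real s2 / geom_ratio p l \<le> energy 0 n"
    by (rule energy_ge) (use res l in \<open>auto simp del: geom_Suc\<close>)
  moreover have "energy 0 n \<le> (\<Sum>i<m1. \<Sum>j<m2. v (\<alpha> i - \<beta> j))"
  proof -
    have "energy 0 n = (\<Sum>i<m1. \<Sum>j<m2. trunc D (\<alpha> i - \<beta> j))"
      unfolding energy_def pair_energy_def using X.nonneg Y.nonneg by (intro sum.cong) auto
    moreover have "trunc D (\<alpha> i - \<beta> j) \<le> v (\<alpha> i - \<beta> j)" if "i < m1" "j < m2" for i j
      using nz[OF that] by (simp add: trunc_def)
    ultimately show ?thesis by (auto intro!: sum_mono)
  qed
  moreover have "(\<Sum>i<m1. \<Sum>j<m2. v (\<alpha> i - \<beta> j)) = real (multiplicity (int p) (resultant f g))"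
  proof -
    have "2 * v ?P = v (?P\<^sup>2)" using P by (simp add: v_power)
    also have "\<dots> = 2 * v (of_int (resultant f g))" unfolding r[symmetric] using r0 by (simp add: v_power)
    finally have "v ?P = real (multiplicity (int p) (resultant f g))" using r0 by (simp add: v_int)
    moreover have "v ?P = (\<Sum>i<m1. \<Sum>j<m2. v (\<alpha> i - \<beta> j))"
    proof -
      have "v (\<Prod>j<m2. \<alpha> i - \<beta> j) = (\<Sum>j<m2. v (\<alpha> i - \<beta> j))" if "i < m1" for i
        using nz[OF that] by (intro v_prod) auto
      moreover have "v ?P = (\<Sum>i<m1. v (\<Prod>j<m2. \<alpha> i - \<beta> j))"
        using nz by (intro v_prod) auto
      ultimately show ?thesis by simp
    qed
    ultimately show ?thesis by simp
  qed
  ultimately show ?thesis using TD unfolding Phi0 by (auto simp: min_def max_def split: if_splits)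
qed

end

section \<open>The exponent \<open>k\<close> in closed form, and the conclusion\<close>

lemma geom_closed_form:
  assumes "p > 1" shows "(real p - 1) * real (geom p l) = real p ^ l - 1"
  by (induction l) (simp_all add: algebra_simps)

text \<open>Take \<open>l = k + 1\<close>, the floor of the logarithm. Then
  \<open>(p - 1) * m + 1 < p ^ (l + 1)\<close> is the first claim, and the denominator equals
  \<open>p * (p ^ l - 1) / p ^ l\<close>.\<close>

lemma level_eq:
  fixes p m :: nat
  assumes p: "p > 1" and m: "m > 0"
  defines "k \<equiv> \<lfloor>log (real p) ((real p - 1) * real m + 1)\<rfloor> - 1"
  obtains l where "m < geom p (Suc l)"
    "real p * (real p - 1) / (real p - real p powr (- real_of_int k)) = 1 / geom_ratio p l"
proof -
  let ?A = "(real p - 1) * real m + 1"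
  define l where "l = nat \<lfloor>log (real p) ?A\<rfloor>"
  have "(real p - 1) * 1 \<le> (real p - 1) * real m"
    using p m by (intro mult_left_mono) auto
  then have A: "real p \<le> ?A" by simp
  then have "1 \<le> log (real p) ?A" using p by (simp add: le_log_iff)
  then have l: "1 \<le> l" "\<lfloor>log (real p) ?A\<rfloor> = int l" by (auto simp: l_def le_nat_iff le_floor_iff)
  have k: "k = int l - 1" by (simp add: k_def l(2))
  have "log (real p) ?A < real (Suc l)" using l(2) by linarith
  then have "?A < real p powr real (Suc l)" using p A by (subst (asm) log_less_iff) auto
  then have "?A < real p ^ Suc l" using p by (subst (asm) powr_realpow) auto
  then have "(real p - 1) * real m < (real p - 1) * real (geom p (Suc l))"
    unfolding geom_closed_form[OF p] by simp
  then have "m < geom p (Suc l)" using p by (simp del: geom_Suc)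
  moreover have "real p * (real p - 1) / (real p - real p powr (- real_of_int k)) = 1 / geom_ratio p l"
  proof -
    have "real p powr (- real_of_int k) = real p powr (1 - real l)" by (simp add: k)
    also have "\<dots> = real p / real p ^ l" using p by (simp add: powr_diff powr_realpow)
    finally have eq: "real p powr (- real_of_int k) = real p / real p ^ l" .
    have pl: "1 < real p ^ l" using p l by (simp add: one_less_power)
    have geq: "real (geom p l) = (real p ^ l - 1) / (real p - 1)"
      using geom_closed_form[OF p, of l] p by (simp add: field_simps)
    have "real p - real p / real p ^ l = real p * (real p ^ l - 1) / real p ^ l"
      using p by (simp add: diff_divide_distrib right_diff_distrib)
    then show ?thesis
      unfolding eq geom_ratio_def geq using pl p by (simp add: field_simps)
  qed
  ultimately show thesis by (rule that)
qed

text \<open>Testing against natural numbers also excludes \<open>e = \<infinity>\<close>; this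
  yields the finiteness of \<open>S\<close>.\<close>

lemma enat_le_if_all_le:
  assumes "\<And>T. enat T \<le> e \<Longrightarrow> T \<le> K" shows "e \<le> enat K"
proof (cases e)
  case infinity
  then show ?thesis using assms[of "Suc K"] by simp
qed (use assms in auto)

theorem theorem2:
  fixes p s1 s2 :: nat and f g :: "int poly"
  assumes "prime p" and "s1 > 0" and "s2 > 0"
    and "monic f" and "monic g"
    and "resultant f g \<noteq> 0"
    and "\<forall>n::int. vp p (poly f n) \<ge> enat s1"
    and "\<forall>n::int. vp p (poly g n) \<ge> enat s2"
  shows "let r = resultant f g;
             S = (SUP n::int. min (vp p (poly f n)) (vp p (poly g n)));
             m = max s1 s2;
             k = \<lfloor>log (real p) ((real p - 1) * real m + 1)\<rfloor> - 1
         in ereal_of_enat (vp p r) \<ge>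
              ereal_of_enat S - ereal (real m)
              + ereal (real p * real s1 * real s2 * (real p - 1)
                       / (real p - real p powr (- real_of_int k)))"
proof -
  obtain v :: "rat alg_closure \<Rightarrow> real" where "padic_val p v"
    using padic_val_exists[OF assms(1) alg_closure_rat_algebraic] by blast
  then interpret padic_val p v .
  have split: "\<exists>\<alpha> :: nat \<Rightarrow> rat alg_closure. map_poly of_int h = root_poly (degree h) \<alpha>"
    if "monic h" for h :: "int poly"
  proof -
    let ?h = "map_poly of_int h :: rat alg_closure poly"
    have lead: "lead_coeff ?h = 1" using that by simp
    then have nz: "?h \<noteq> 0" by auto
    obtain \<alpha> where "?h = smult (lead_coeff ?h) (root_poly (degree ?h) \<alpha>)"
      by (rule alg_closed_root_poly[OF nz])
    then have "?h = root_poly (degree h) \<alpha>" unfolding lead by simp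
    then show ?thesis by (intro exI[of _ \<alpha>])
  qed
  obtain \<alpha> \<beta> :: "nat \<Rightarrow> rat alg_closure" where
    f: "map_poly of_int f = root_poly (degree f) \<alpha>" and g: "map_poly of_int g = root_poly (degree g) \<beta>"
    using split assms(4,5) by metis
  have r: "(of_int (resultant f g))\<^sup>2 = (\<Prod>i<degree f. \<Prod>j<degree g. \<alpha> i - \<beta> j)\<^sup>2"
    unfolding of_int_hom.resultant_hom[symmetric] f g by (rule resultant_root_poly_sq)
  define m where "m = max s1 s2"
  define k where "k = \<lfloor>log (real p) ((real p - 1) * real m + 1)\<rfloor> - 1"
  define C where "C = real p * real s1 * real s2 * (real p - 1) / (real p - real p powr (- real_of_int k))"
  define M where "M = multiplicity (int p) (resultant f g)"
  define S where "S = (SUP n::int. min (vp p (poly f n)) (vp p (poly g n)))"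
  have "m > 0" using assms(2) by (simp add: m_def)
  then obtain l where l: "m < geom p (Suc l)"
    "real p * (real p - 1) / (real p - real p powr (- real_of_int k)) = 1 / geom_ratio p l"
    using level_eq[OF p_gt_1] unfolding k_def by metis
  have "C = real s1 * real s2 * (real p * (real p - 1) / (real p - real p powr (- real_of_int k)))"
    by (simp add: C_def)
  then have C: "C = real s1 * real s2 / geom_ratio p l" unfolding l(2) by simp
  have bound: "real T \<le> real M + real m - C"
    if "enat T \<le> min (vp p (poly f n)) (vp p (poly g n))" for T n
    using resultant_bound[OF f g assms(6) r, of s1 s2 T n l] assms(7,8) that l(1)
    unfolding C M_def m_def by simp
  let ?K = "nat \<lfloor>real M + real m - C\<rfloor>"
  \<comment> \<open>The choice \<open>T = 0\<close> is always admissible, so the bound is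
    nonnegative and \<open>?K\<close> merely rounds it down.\<close>
  have "0 \<le> real M + real m - C" using bound[of 0 0] by (simp add: zero_enat_def[symmetric])
  then have K: "real ?K \<le> real M + real m - C" by simp
  have "S \<le> enat ?K"
    unfolding S_def by (intro SUP_least enat_le_if_all_le le_nat_floor bound)
  then obtain S0 where S0: "S = enat S0" "S0 \<le> ?K" by (cases S) auto
  then have "real S0 - real m + C \<le> real M" using K by linarith
  then have "ereal_of_enat S - ereal (real m) + ereal C \<le> ereal_of_enat (vp p (resultant f g))"
    using assms(6) S0 by (simp add: vp_def M_def)
  then show ?thesis
    unfolding Let_def S_def C_def k_def m_def .
qed

end
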